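(* Let $(E,\rho)$ be an anchored bundle over a smooth manifold $M$ with $m$ vector bundle connections $\nabla^1,\dots,\nabla^m$, and let $t$ be a tensor field on $M$ of type $(r,s)$ with $r+s=m$ such that the compatibility condition ${}^E\nabla^{comb}(t)=0$ holds. Extend $\nabla^1,\dots,\nabla^m$ to the corresponding Cartan connections $\tilde\nabla^1,\dots,\tilde\nabla^m$ on the free Lie algebroid $FR(E)$ generated by $(E,\rho)$. Then $(FR(E),\tilde\nabla^1,\dots,\tilde\nabla^m)$ is compatible with $t$, i.e. ${}^{FR(E)}\tilde\nabla^{comb}(t)=0$; equivalently, $t$ is invariant with respect to the natural Lie algebroid representation ${}^{FR(E)}\tilde\nabla^{comb}$ of $FR(E)$ on tensors of this type.
   Context: Everything is smooth and real, and bundle maps cover the identity of $M$. Vector bundles may have infinite rank in the sense of being unions $E=\bigcup_d E_d$ of increasing sequences of finite-rank vector bundles, with $\Gamma(E)=\bigcup_d\Gamma(E_d)$; a connection is a map $\nabla\colon\Gamma(E)\to\Omega^1(M)\otimes_{C^\infty(M)}\Gamma(E)$ satisfying the Leibniz rule. An anchored bundle is a vector bundle $E\to M$ with a bundle map $\rho\colon E\to TM$ over the identity. A connection $\nabla$ on an anchored bundle $E$ induces an $E$-connection ${}^E\nabla$ on $TM$ by $${}^E\nabla_s v=[\rho(s),v]+\rho(\nabla_v s),\qquad s\in\Gamma(E),\ v\in\Gamma(TM),$$ and on $T^*M$ by duality: $({}^E\nabla_s\omega)(v)=\rho(s)(\omega(v))-\omega({}^E\nabla_s v)$. Given $m$ connections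 $\nabla^1,\dots,\nabla^m$ on $E$, and tensors of type $(r,s)$ with $r+s=m$ viewed as sections of an $m$-fold tensor product of copies of $TM$ and $T^*M$, the operator $${}^E\nabla^{comb}={}^E\nabla^1\otimes\mathrm{Id}\otimes\cdots\otimes\mathrm{Id}+\cdots+\mathrm{Id}\otimes\cdots\otimes\mathrm{Id}\otimes{}^E\nabla^m$$ is the $E$-connection on this tensor product given on decomposable tensors by the Leibniz rule, with ${}^E\nabla^i$ acting on the $i$-th factor. The tensor $t$ is called compatible with $(E,\nabla^1,\dots,\nabla^m)$ if ${}^E\nabla^{comb}_s(t)=0$ for all $s\in\Gamma(E)$. The same definitions are applied to $FR(E)$ with its anchor and the connections $\tilde\nabla^i$. A Lie algebroid is an anchored bundle $(A,\rho)$ with a Lie bracket on $\Gamma(A)$ satisfying $[s,fs']=f[s,s']+\rho(s)(f)s'$. A connection $\nabla$ on $A$ is a Cartan connection if for all $s,s'\in\Gamma(A)$ $$\nabla[s,s']=\mathcal L_s(\nabla s')-\mathcal L_{s'}(\nabla s)-\nabla_{\rho(\nabla s)}s'+\nabla_{\rho(\nabla s')}s,$$ where $\mathcal L_s(\omega\otimes s')=\mathcal L_{\rho(s)}\omega\otimes s'+\omega\otimes[s,s']$ and $\nabla_{\rho(\nabla s)}s'$ is the $A$-valued 1-form $v\mapsto\nabla_{\rho(\nabla_v s)}s'$. The free Lie algebroid $FR(E)$ generated by $(E,\rho)$ (Kapranov) is the Lie algebroid over $M$ with an embedding of anchored bundles $\imath\colon E\to FR(E)$ such that every morphism of anchored bundles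 from $E$ to a Lie algebroid $A$ over $M$ extends uniquely to a Lie algebroid morphism $FR(E)\to A$. Its sections are spanned over $C^\infty(M)$ by iterated brackets of sections of $E$. For any connection $\nabla$ on $E$ there is a unique Cartan connection $\tilde\nabla$ on $FR(E)$ extending it, i.e. with $\tilde\nabla_v(\imath(s))=\imath(\nabla_v s)$; this is the Cartan connection corresponding to $\nabla$. A representation of a Lie algebroid $A$ on a vector bundle $V$ is a flat $A$-connection on $V$, i.e. ${}^A\nabla_{[s,s']}=[{}^A\nabla_s,{}^A\nabla_{s'}]$. When the $\nabla^i$ are Cartan connections on a Lie algebroid $A$, each ${}^A\nabla^i$ and ${}^A\nabla^{comb}$ are representations. *)

theory Defs
  imports "HOL-Analysis.Analysis" "HOL-Library.Function_Algebras"
begin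

instantiation "fun" :: (type, real_vector) real_vector
begin

definition scaleR_fun :: "real \<Rightarrow> ('a \<Rightarrow> 'b) \<Rightarrow> 'a \<Rightarrow> 'b" where
  "scaleR_fun c f = (\<lambda>x. c *\<^sub>R f x)"

instance
  by standard (auto simp: scaleR_fun_def fun_eq_iff algebra_simps)

end


section \<open>Smooth manifolds\<close>

text \<open>
  \<open>R^n\<close> is \<^const>\<open>Euclidean_space\<close>, whose points are the functions \<open>nat \<Rightarrow> real\<close> vanishing from
  index \<open>n\<close> on; so the dimension is an ordinary natural number and may be \<open>0\<close>.  A function on an
  open subset is of class \<open>C^k\<close> if its iterated partial derivatives up to order \<open>k\<close> exist and are
  continuous.
\<close>

definition partial_deriv :: "nat \<Rightarrow> ((nat \<Rightarrow> real) \<Rightarrow> real) \<Rightarrow> (nat \<Rightarrow> real) \<Rightarrow> real" where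
  "partial_deriv i f x = deriv (\<lambda>t. f (x(i := t))) (x i)"

primrec Ck_on :: "nat \<Rightarrow> (nat \<Rightarrow> real) set \<Rightarrow> nat \<Rightarrow> ((nat \<Rightarrow> real) \<Rightarrow> real) \<Rightarrow> bool" where
  "Ck_on n V 0 f \<longleftrightarrow> continuous_on V f"
| "Ck_on n V (Suc k) f \<longleftrightarrow> continuous_on V f \<and>
     (\<forall>i<n. (\<forall>x\<in>V. (\<lambda>t. f (x(i := t))) differentiable (at (x i))) \<and>
            Ck_on n V k (partial_deriv i f))"

definition Cinf_on :: "nat \<Rightarrow> (nat \<Rightarrow> real) set \<Rightarrow> ((nat \<Rightarrow> real) \<Rightarrow> real) \<Rightarrow> bool" where
  "Cinf_on n V f \<longleftrightarrow> (\<forall>k. Ck_on n V k f)"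

record 'm mfd =
  mdim :: nat
  charts :: "('m set \<times> ('m \<Rightarrow> nat \<Rightarrow> real)) set"

definition smooth_manifold ::
    "('m::{t2_space,second_countable_topology}) mfd \<Rightarrow> bool" where
  "smooth_manifold M \<longleftrightarrow>
     (\<Union>(U, \<phi>)\<in>charts M. U) = UNIV \<and>
     (\<forall>(U, \<phi>)\<in>charts M. open U \<and> openin (Euclidean_space (mdim M)) (\<phi> ` U) \<and>
        homeomorphism U (\<phi> ` U) \<phi> (inv_into U \<phi>)) \<and>
     (\<forall>(U, \<phi>)\<in>charts M. \<forall>(V, \<psi>)\<in>charts M. \<forall>i<mdim M.
        Cinf_on (mdim M) (\<phi> ` (U \<inter> V)) (\<lambda>x. \<psi> (inv_into U \<phi> x) i))"

definition smooth_on :: "'m mfd \<Rightarrow> 'm set \<Rightarrow> ('m \<Rightarrow> real) \<Rightarrow> bool" where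
  "smooth_on M W f \<longleftrightarrow>
     (\<forall>(U, \<phi>)\<in>charts M. Cinf_on (mdim M) (\<phi> ` (U \<inter> W)) (\<lambda>x. f (inv_into U \<phi> x)))"

definition Cinf :: "'m mfd \<Rightarrow> ('m \<Rightarrow> real) set" where
  "Cinf M = {f. smooth_on M UNIV f}"


section \<open>Vector bundles\<close>

text \<open>
  A vector bundle is given by its fibres, realised as linear subspaces of one ambient real vector
  space (for instance their direct sum; no topology on that space is involved), together with its
  sheaf of smooth local sections, which has to be locally free on frames that are fibrewise bases.
  Such a frame is the same as a local trivialisation.  The rank is finite and may differ between
  connected components.
\<close>

record ('m, 'v) vbundle =
  fibre :: "'m \<Rightarrow> 'v set"
  sections_on :: "'m set \<Rightarrow> ('m \<Rightarrow> 'v) set"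

definition local_frame ::
    "'m::topological_space mfd \<Rightarrow> ('m, 'v::real_vector) vbundle \<Rightarrow> 'm set \<Rightarrow> nat \<Rightarrow> (nat \<Rightarrow> 'm \<Rightarrow> 'v) \<Rightarrow> bool"
  where
  "local_frame M E U k e \<longleftrightarrow> open U \<and>
     (\<forall>q\<in>U. inj_on (\<lambda>i. e i q) {..<k} \<and> independent ((\<lambda>i. e i q) ` {..<k}) \<and>
             span ((\<lambda>i. e i q) ` {..<k}) = fibre E q) \<and>
     (\<forall>W s. open W \<longrightarrow> W \<subseteq> U \<longrightarrow>
        (s \<in> sections_on E W \<longleftrightarrow>
         (\<exists>c. (\<forall>i<k. smooth_on M W (c i)) \<and> (\<forall>q\<in>W. s q = (\<Sum>i<k. c i q *\<^sub>R e i q)))))"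

definition vector_bundle ::
    "'m::topological_space mfd \<Rightarrow> ('m, 'v::real_vector) vbundle \<Rightarrow> bool" where
  "vector_bundle M E \<longleftrightarrow>
     (\<forall>p. subspace (fibre E p)) \<and>
     (\<forall>U W s. open U \<longrightarrow> open W \<longrightarrow> W \<subseteq> U \<longrightarrow> s \<in> sections_on E U \<longrightarrow> s \<in> sections_on E W) \<and>
     (\<forall>U s. open U \<longrightarrow>
        (\<forall>p\<in>U. \<exists>W. open W \<and> p \<in> W \<and> W \<subseteq> U \<and> s \<in> sections_on E W) \<longrightarrow>
        s \<in> sections_on E U) \<and>
     (\<exists>r. \<forall>p. \<exists>U k e. p \<in> U \<and> k \<le> r \<and> local_frame M E U k e)"

text \<open>
  Bundles of possibly infinite rank are increasing sequences of finite-rank bundles; a finite-rank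
  bundle is a constant sequence.
\<close>

type_synonym ('m, 'v) ivbundle = "nat \<Rightarrow> ('m, 'v) vbundle"

definition ivector_bundle ::
    "'m::topological_space mfd \<Rightarrow> ('m, 'v::real_vector) ivbundle \<Rightarrow> bool" where
  "ivector_bundle M E \<longleftrightarrow>
     (\<forall>d. vector_bundle M (E d)) \<and>
     (\<forall>d p. fibre (E d) p \<subseteq> fibre (E (Suc d)) p) \<and>
     (\<forall>d U. open U \<longrightarrow> sections_on (E d) U \<subseteq> sections_on (E (Suc d)) U)"

definition ifibre :: "('m, 'v) ivbundle \<Rightarrow> 'm \<Rightarrow> 'v set" where
  "ifibre E p = (\<Union>d. fibre (E d) p)"

definition Sec :: "('m, 'v) ivbundle \<Rightarrow> ('m \<Rightarrow> 'v) set" where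
  "Sec E = (\<Union>d. sections_on (E d) UNIV)"

text \<open>Bundle maps cover the identity; on sections they act by \<^term>\<open>app\<close>.\<close>

definition app :: "('m \<Rightarrow> 'v \<Rightarrow> 'w) \<Rightarrow> ('m \<Rightarrow> 'v) \<Rightarrow> 'm \<Rightarrow> 'w" where
  "app \<phi> s = (\<lambda>p. \<phi> p (s p))"

definition bundle_map ::
    "('m::topological_space, 'v::real_vector) ivbundle \<Rightarrow> ('m, 'w::real_vector) ivbundle \<Rightarrow>
     ('m \<Rightarrow> 'v \<Rightarrow> 'w) \<Rightarrow> bool" where
  "bundle_map E F \<phi> \<longleftrightarrow>
     (\<forall>d. \<exists>d'.
        (\<forall>p. \<forall>v\<in>fibre (E d) p. \<phi> p v \<in> fibre (F d') p) \<and>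
        (\<forall>p. \<forall>v\<in>fibre (E d) p. \<forall>w\<in>fibre (E d) p. \<forall>a b.
           \<phi> p (a *\<^sub>R v + b *\<^sub>R w) = a *\<^sub>R \<phi> p v + b *\<^sub>R \<phi> p w) \<and>
        (\<forall>U s. open U \<longrightarrow> s \<in> sections_on (E d) U \<longrightarrow> app \<phi> s \<in> sections_on (F d') U))"

definition fscale :: "('m \<Rightarrow> real) \<Rightarrow> ('m \<Rightarrow> 'v::real_vector) \<Rightarrow> 'm \<Rightarrow> 'v" where
  "fscale f s = (\<lambda>p. f p *\<^sub>R s p)"


section \<open>Vector fields, forms and tensor fields\<close>

text \<open>
  Tangent vectors at \<open>p\<close> are the derivations at \<open>p\<close> of the algebra of smooth functions, normalised
  to be zero on functions that are not smooth.  A vector field is smooth if it maps smooth functions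
  to smooth functions.
\<close>

type_synonym 'm tvec = "('m \<Rightarrow> real) \<Rightarrow> real"

definition tangent_space :: "'m mfd \<Rightarrow> 'm \<Rightarrow> 'm tvec set" where
  "tangent_space M p = {D.
     (\<forall>f\<in>Cinf M. \<forall>g\<in>Cinf M. \<forall>a b. D (\<lambda>x. a * f x + b * g x) = a * D f + b * D g) \<and>
     (\<forall>f\<in>Cinf M. \<forall>g\<in>Cinf M. D (\<lambda>x. f x * g x) = D f * g p + f p * D g) \<and>
     (\<forall>f. f \<notin> Cinf M \<longrightarrow> D f = 0)}"

definition deriv_along :: "('m \<Rightarrow> 'm tvec) \<Rightarrow> ('m \<Rightarrow> real) \<Rightarrow> 'm \<Rightarrow> real" where
  "deriv_along X f = (\<lambda>p. X p f)"

definition tangent_bundle :: "'m mfd \<Rightarrow> ('m, 'm tvec) ivbundle" where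
  "tangent_bundle M = (\<lambda>_. \<lparr>fibre = tangent_space M,
     sections_on = (\<lambda>U. {X. (\<forall>p\<in>U. X p \<in> tangent_space M p) \<and>
                             (\<forall>f\<in>Cinf M. smooth_on M U (deriv_along X f))})\<rparr>)"

definition vfields :: "'m mfd \<Rightarrow> ('m \<Rightarrow> 'm tvec) set" where
  "vfields M = Sec (tangent_bundle M)"

definition lie_bracket :: "('m \<Rightarrow> 'm tvec) \<Rightarrow> ('m \<Rightarrow> 'm tvec) \<Rightarrow> 'm \<Rightarrow> 'm tvec" where
  "lie_bracket X Y = (\<lambda>p f. X p (deriv_along Y f) - Y p (deriv_along X f))"

text \<open>
  Since vector fields form a finitely generated projective module over the smooth functions,
  elements of \<open>\<Omega>^1(M) \<otimes> S\<close> are the function-linear maps from vector fields to \<open>S\<close>; the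
  decomposable element \<open>\<omega> \<otimes> s\<close> is the map \<open>v \<mapsto> \<omega>(v) s\<close>.
\<close>

definition vforms ::
    "'m mfd \<Rightarrow> ('m \<Rightarrow> 'v::real_vector) set \<Rightarrow> (('m \<Rightarrow> 'm tvec) \<Rightarrow> 'm \<Rightarrow> 'v) set" where
  "vforms M S = {\<theta>.
     (\<forall>v\<in>vfields M. \<theta> v \<in> S) \<and>
     (\<forall>v\<in>vfields M. \<forall>w\<in>vfields M. \<forall>f\<in>Cinf M. \<forall>g\<in>Cinf M.
        \<theta> (fscale f v + fscale g w) = fscale f (\<theta> v) + fscale g (\<theta> w))}"

type_synonym 'm form = "('m \<Rightarrow> 'm tvec) \<Rightarrow> 'm \<Rightarrow> real"

text \<open>Outside their domain, 1-forms and tensor fields are normalised to be zero.\<close>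

definition one_forms :: "'m mfd \<Rightarrow> 'm form set" where
  "one_forms M = {\<omega> \<in> vforms M (Cinf M). \<forall>v. v \<notin> vfields M \<longrightarrow> \<omega> v = 0}"

text \<open>
  A list \<open>\<kappa>\<close> of variances records which factor of the tensor product is \<open>TM\<close> (\<open>Contra\<close>) and which
  is \<open>T^*M\<close> (\<open>Co\<close>).  A tensor field is a function-multilinear map with one argument for each factor,
  a 1-form \<open>\<alpha> i\<close> if the \<open>i\<close>-th factor is \<open>TM\<close> and a vector field \<open>X i\<close> if it is \<open>T^*M\<close>; the other
  entries of \<open>\<alpha>\<close> and \<open>X\<close> are ignored.
\<close>

datatype variance = Contra | Co

type_synonym 'm tensor = "(nat \<Rightarrow> 'm form) \<Rightarrow> (nat \<Rightarrow> 'm \<Rightarrow> 'm tvec) \<Rightarrow> 'm \<Rightarrow> real"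

definition tensor_args ::
    "'m mfd \<Rightarrow> variance list \<Rightarrow> (nat \<Rightarrow> 'm form) \<Rightarrow> (nat \<Rightarrow> 'm \<Rightarrow> 'm tvec) \<Rightarrow> bool" where
  "tensor_args M \<kappa> \<alpha> X \<longleftrightarrow>
     (\<forall>i<length \<kappa>. case \<kappa> ! i of Contra \<Rightarrow> \<alpha> i \<in> one_forms M | Co \<Rightarrow> X i \<in> vfields M)"

definition tensor_fields :: "'m mfd \<Rightarrow> variance list \<Rightarrow> 'm tensor set" where
  "tensor_fields M \<kappa> = {t.
     (\<forall>\<alpha> X. tensor_args M \<kappa> \<alpha> X \<longrightarrow> t \<alpha> X \<in> Cinf M) \<and>
     (\<forall>\<alpha> X. \<not> tensor_args M \<kappa> \<alpha> X \<longrightarrow> t \<alpha> X = 0) \<and>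
     (\<forall>\<alpha> X \<alpha>' X'.
        (\<forall>i<length \<kappa>. case \<kappa> ! i of Contra \<Rightarrow> \<alpha> i = \<alpha>' i | Co \<Rightarrow> X i = X' i) \<longrightarrow>
        t \<alpha> X = t \<alpha>' X') \<and>
     (\<forall>\<alpha> X i f g. tensor_args M \<kappa> \<alpha> X \<longrightarrow> i < length \<kappa> \<longrightarrow> f \<in> Cinf M \<longrightarrow> g \<in> Cinf M \<longrightarrow>
        (case \<kappa> ! i of
           Contra \<Rightarrow> (\<forall>\<beta>\<in>one_forms M. \<forall>\<gamma>\<in>one_forms M.
             t (\<alpha>(i := (\<lambda>v. fscale f (\<beta> v) + fscale g (\<gamma> v)))) X =
             fscale f (t (\<alpha>(i := \<beta>)) X) + fscale g (t (\<alpha>(i := \<gamma>)) X))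
         | Co \<Rightarrow> (\<forall>v\<in>vfields M. \<forall>w\<in>vfields M.
             t \<alpha> (X(i := fscale f v + fscale g w)) =
             fscale f (t \<alpha> (X(i := v))) + fscale g (t \<alpha> (X(i := w))))))}"


section \<open>Anchored bundles and connections\<close>

definition anchored_bundle ::
    "'m::topological_space mfd \<Rightarrow> ('m, 'v::real_vector) ivbundle \<Rightarrow> ('m \<Rightarrow> 'v \<Rightarrow> 'm tvec) \<Rightarrow> bool"
  where
  "anchored_bundle M E \<rho> \<longleftrightarrow> ivector_bundle M E \<and> bundle_map E (tangent_bundle M) \<rho>"

definition anchored_morphism ::
    "('m::topological_space, 'v::real_vector) ivbundle \<Rightarrow> ('m \<Rightarrow> 'v \<Rightarrow> 'm tvec) \<Rightarrow>
     ('m, 'w::real_vector) ivbundle \<Rightarrow> ('m \<Rightarrow> 'w \<Rightarrow> 'm tvec) \<Rightarrow> ('m \<Rightarrow> 'v \<Rightarrow> 'w) \<Rightarrow> bool" where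
  "anchored_morphism E \<rho> F \<sigma> \<phi> \<longleftrightarrow>
     bundle_map E F \<phi> \<and> (\<forall>p. \<forall>v\<in>ifibre E p. \<sigma> p (\<phi> p v) = \<rho> p v)"

text \<open>The covariant derivative of \<open>s\<close> along \<open>v\<close> is \<open>nab s v\<close>.\<close>

type_synonym ('m, 'v) conn = "('m \<Rightarrow> 'v) \<Rightarrow> ('m \<Rightarrow> 'm tvec) \<Rightarrow> 'm \<Rightarrow> 'v"

definition connection ::
    "'m mfd \<Rightarrow> ('m, 'v::real_vector) ivbundle \<Rightarrow> ('m, 'v) conn \<Rightarrow> bool" where
  "connection M E nab \<longleftrightarrow>
     (\<forall>s\<in>Sec E. nab s \<in> vforms M (Sec E)) \<and>
     (\<forall>s\<in>Sec E. \<forall>s'\<in>Sec E. \<forall>v\<in>vfields M. nab (s + s') v = nab s v + nab s' v) \<and>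
     (\<forall>s\<in>Sec E. \<forall>f\<in>Cinf M. \<forall>v\<in>vfields M.
        nab (fscale f s) v = fscale (deriv_along v f) s + fscale f (nab s v))"

definition Econn_TM ::
    "('m \<Rightarrow> 'v \<Rightarrow> 'm tvec) \<Rightarrow> ('m, 'v) conn \<Rightarrow> ('m \<Rightarrow> 'v) \<Rightarrow> ('m \<Rightarrow> 'm tvec) \<Rightarrow> 'm \<Rightarrow> 'm tvec" where
  "Econn_TM \<rho> nab s v = lie_bracket (app \<rho> s) v + app \<rho> (nab s v)"

definition Econn_T'M ::
    "'m mfd \<Rightarrow> ('m \<Rightarrow> 'v \<Rightarrow> 'm tvec) \<Rightarrow> ('m, 'v) conn \<Rightarrow> ('m \<Rightarrow> 'v) \<Rightarrow> 'm form \<Rightarrow> 'm form" where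
  "Econn_T'M M \<rho> nab s \<omega> = (\<lambda>v. if v \<in> vfields M
     then deriv_along (app \<rho> s) (\<omega> v) - \<omega> (Econn_TM \<rho> nab s v) else 0)"

text \<open>
  The operator acting on the \<open>i\<close>-th tensor factor by the \<open>E\<close>-connection of \<open>nab i\<close>, written in terms
  of the values of a tensor field on its arguments (an argument is dual to the factor it is paired
  with, whence the signs).  That this is the operator given by the Leibniz rule on decomposable
  tensors is the content of \<open>Econn_comb_tensor_product\<close> below.
\<close>

definition Econn_comb ::
    "'m mfd \<Rightarrow> ('m \<Rightarrow> 'v \<Rightarrow> 'm tvec) \<Rightarrow> variance list \<Rightarrow> (nat \<Rightarrow> ('m, 'v) conn) \<Rightarrow>
     ('m \<Rightarrow> 'v) \<Rightarrow> 'm tensor \<Rightarrow> 'm tensor" where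
  "Econn_comb M \<rho> \<kappa> nab s t = (\<lambda>\<alpha> X. if tensor_args M \<kappa> \<alpha> X
     then deriv_along (app \<rho> s) (t \<alpha> X) -
       (\<Sum>i<length \<kappa>. case \<kappa> ! i of
          Contra \<Rightarrow> t (\<alpha>(i := Econn_T'M M \<rho> (nab i) s (\<alpha> i))) X
        | Co \<Rightarrow> t \<alpha> (X(i := Econn_TM \<rho> (nab i) s (X i))))
     else 0)"

definition compatible ::
    "'m mfd \<Rightarrow> ('m, 'v) ivbundle \<Rightarrow> ('m \<Rightarrow> 'v \<Rightarrow> 'm tvec) \<Rightarrow> (nat \<Rightarrow> ('m, 'v) conn) \<Rightarrow>
     variance list \<Rightarrow> 'm tensor \<Rightarrow> bool" where
  "compatible M E \<rho> nab \<kappa> t \<longleftrightarrow> (\<forall>s\<in>Sec E. Econn_comb M \<rho> \<kappa> nab s t = 0)"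


section \<open>Lie algebroids\<close>

definition lie_algebroid ::
    "'m::topological_space mfd \<Rightarrow> ('m, 'v::real_vector) ivbundle \<Rightarrow> ('m \<Rightarrow> 'v \<Rightarrow> 'm tvec) \<Rightarrow>
     (('m \<Rightarrow> 'v) \<Rightarrow> ('m \<Rightarrow> 'v) \<Rightarrow> 'm \<Rightarrow> 'v) \<Rightarrow> bool" where
  "lie_algebroid M A \<rho> br \<longleftrightarrow>
     anchored_bundle M A \<rho> \<and>
     (\<forall>s\<in>Sec A. \<forall>s'\<in>Sec A. br s s' \<in> Sec A) \<and>
     (\<forall>s\<in>Sec A. \<forall>s'\<in>Sec A. \<forall>u\<in>Sec A. \<forall>a b.
        br (a *\<^sub>R s + b *\<^sub>R s') u = a *\<^sub>R br s u + b *\<^sub>R br s' u) \<and>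
     (\<forall>s\<in>Sec A. \<forall>s'\<in>Sec A. br s s' = - br s' s) \<and>
     (\<forall>s\<in>Sec A. \<forall>s'\<in>Sec A. \<forall>u\<in>Sec A.
        br s (br s' u) + br s' (br u s) + br u (br s s') = 0) \<and>
     (\<forall>s\<in>Sec A. \<forall>s'\<in>Sec A. \<forall>f\<in>Cinf M.
        br s (fscale f s') = fscale f (br s s') + fscale (deriv_along (app \<rho> s) f) s')"

definition lie_algebroid_morphism ::
    "('m::topological_space, 'v::real_vector) ivbundle \<Rightarrow> ('m \<Rightarrow> 'v \<Rightarrow> 'm tvec) \<Rightarrow>
     (('m \<Rightarrow> 'v) \<Rightarrow> ('m \<Rightarrow> 'v) \<Rightarrow> 'm \<Rightarrow> 'v) \<Rightarrow>
     ('m, 'w::real_vector) ivbundle \<Rightarrow> ('m \<Rightarrow> 'w \<Rightarrow> 'm tvec) \<Rightarrow>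
     (('m \<Rightarrow> 'w) \<Rightarrow> ('m \<Rightarrow> 'w) \<Rightarrow> 'm \<Rightarrow> 'w) \<Rightarrow> ('m \<Rightarrow> 'v \<Rightarrow> 'w) \<Rightarrow> bool" where
  "lie_algebroid_morphism A \<rho> br B \<sigma> br' \<phi> \<longleftrightarrow>
     anchored_morphism A \<rho> B \<sigma> \<phi> \<and>
     (\<forall>s\<in>Sec A. \<forall>s'\<in>Sec A. app \<phi> (br s s') = br' (app \<phi> s) (app \<phi> s'))"

inductive_set iterated_brackets ::
    "(('m \<Rightarrow> 'v) \<Rightarrow> ('m \<Rightarrow> 'v) \<Rightarrow> 'm \<Rightarrow> 'v) \<Rightarrow> ('m \<Rightarrow> 'v) set \<Rightarrow> ('m \<Rightarrow> 'v) set"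
  for br S where
  generator: "s \<in> S \<Longrightarrow> s \<in> iterated_brackets br S"
| bracket: "s \<in> iterated_brackets br S \<Longrightarrow> s' \<in> iterated_brackets br S \<Longrightarrow>
            br s s' \<in> iterated_brackets br S"

definition Cinf_span :: "'m mfd \<Rightarrow> ('m \<Rightarrow> 'v::real_vector) set \<Rightarrow> ('m \<Rightarrow> 'v) set" where
  "Cinf_span M S =
     {(\<Sum>j<k. fscale (f j) (b j)) | (k::nat) f b. \<forall>j<k. f j \<in> Cinf M \<and> b j \<in> S}"

text \<open>
  The universal property ranges over Lie algebroids whose fibres lie in a type \<open>'c\<close>, passed as a
  parameter because HOL cannot quantify over types inside a formula.  A theorem assuming
  \<open>free_lie_algebroid\<close> at an arbitrary \<open>'c\<close> therefore needs the universal property only for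
  that \<open>'c\<close>.  The last conjunct says that the sections are generated by iterated brackets of
  sections of \<open>E\<close>.
\<close>

definition free_lie_algebroid ::
    "'c::real_vector itself \<Rightarrow> 'm::topological_space mfd \<Rightarrow>
     ('m, 'v::real_vector) ivbundle \<Rightarrow> ('m \<Rightarrow> 'v \<Rightarrow> 'm tvec) \<Rightarrow>
     ('m, 'w::real_vector) ivbundle \<Rightarrow> ('m \<Rightarrow> 'w \<Rightarrow> 'm tvec) \<Rightarrow>
     (('m \<Rightarrow> 'w) \<Rightarrow> ('m \<Rightarrow> 'w) \<Rightarrow> 'm \<Rightarrow> 'w) \<Rightarrow> ('m \<Rightarrow> 'v \<Rightarrow> 'w) \<Rightarrow> bool" where
  "free_lie_algebroid TC M E \<rho> F \<sigma> br \<iota> \<longleftrightarrow>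
     lie_algebroid M F \<sigma> br \<and>
     anchored_morphism E \<rho> F \<sigma> \<iota> \<and> (\<forall>p. inj_on (\<iota> p) (ifibre E p)) \<and>
     (\<forall>(A :: ('m, 'c) ivbundle) \<tau> br' \<phi>.
        lie_algebroid M A \<tau> br' \<and> anchored_morphism E \<rho> A \<tau> \<phi> \<longrightarrow>
        (\<exists>\<psi>. lie_algebroid_morphism F \<sigma> br A \<tau> br' \<psi> \<and>
              (\<forall>p. \<forall>v\<in>ifibre E p. \<psi> p (\<iota> p v) = \<phi> p v) \<and>
              (\<forall>\<psi>'. lie_algebroid_morphism F \<sigma> br A \<tau> br' \<psi>' \<and>
                     (\<forall>p. \<forall>v\<in>ifibre E p. \<psi>' p (\<iota> p v) = \<phi> p v) \<longrightarrow>
                     (\<forall>p. \<forall>w\<in>ifibre F p. \<psi>' p w = \<psi> p w)))) \<and>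
     Sec F = Cinf_span M (iterated_brackets br (app \<iota> ` Sec E))"

text \<open>
  The value at \<open>v\<close> of the Lie derivative along \<open>s\<close> of an \<open>A\<close>-valued 1-form \<open>\<theta>\<close>; see
  \<open>lie_deriv_vform_tensor\<close> below for \<open>\<theta> = \<omega> \<otimes> s'\<close>.
\<close>

definition lie_deriv_vform ::
    "('m \<Rightarrow> 'v::real_vector \<Rightarrow> 'm tvec) \<Rightarrow> (('m \<Rightarrow> 'v) \<Rightarrow> ('m \<Rightarrow> 'v) \<Rightarrow> 'm \<Rightarrow> 'v) \<Rightarrow> ('m \<Rightarrow> 'v) \<Rightarrow>
     (('m \<Rightarrow> 'm tvec) \<Rightarrow> 'm \<Rightarrow> 'v) \<Rightarrow> ('m \<Rightarrow> 'm tvec) \<Rightarrow> 'm \<Rightarrow> 'v" where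
  "lie_deriv_vform \<rho> br s \<theta> v = br s (\<theta> v) - \<theta> (lie_bracket (app \<rho> s) v)"

definition cartan_connection ::
    "'m mfd \<Rightarrow> ('m, 'v::real_vector) ivbundle \<Rightarrow> ('m \<Rightarrow> 'v \<Rightarrow> 'm tvec) \<Rightarrow>
     (('m \<Rightarrow> 'v) \<Rightarrow> ('m \<Rightarrow> 'v) \<Rightarrow> 'm \<Rightarrow> 'v) \<Rightarrow> ('m, 'v) conn \<Rightarrow> bool" where
  "cartan_connection M A \<rho> br nab \<longleftrightarrow>
     connection M A nab \<and>
     (\<forall>s\<in>Sec A. \<forall>s'\<in>Sec A. \<forall>v\<in>vfields M.
        nab (br s s') v =
          lie_deriv_vform \<rho> br s (nab s') v - lie_deriv_vform \<rho> br s' (nab s) v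
          - nab s' (app \<rho> (nab s v)) + nab s (app \<rho> (nab s' v)))"

definition extends_connection ::
    "'m mfd \<Rightarrow> ('m, 'v) ivbundle \<Rightarrow> ('m \<Rightarrow> 'v \<Rightarrow> 'w) \<Rightarrow> ('m, 'v) conn \<Rightarrow> ('m, 'w) conn \<Rightarrow> bool" where
  "extends_connection M E \<iota> nab nab' \<longleftrightarrow>
     (\<forall>s\<in>Sec E. \<forall>v\<in>vfields M. nab' (app \<iota> s) v = app \<iota> (nab s v))"

text \<open>
  \<open>A\<close>-connections on a module \<open>V\<close> of sections with multiplication \<open>smul\<close> by smooth functions; a
  representation is a flat \<open>A\<close>-connection.
\<close>

definition module_connection ::
    "'m mfd \<Rightarrow> ('m, 'v::real_vector) ivbundle \<Rightarrow> ('m \<Rightarrow> 'v \<Rightarrow> 'm tvec) \<Rightarrow>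
     'w::ab_group_add set \<Rightarrow> (('m \<Rightarrow> real) \<Rightarrow> 'w \<Rightarrow> 'w) \<Rightarrow> (('m \<Rightarrow> 'v) \<Rightarrow> 'w \<Rightarrow> 'w) \<Rightarrow> bool" where
  "module_connection M A \<rho> V smul D \<longleftrightarrow>
     (\<forall>s\<in>Sec A. \<forall>w\<in>V. D s w \<in> V) \<and>
     (\<forall>s\<in>Sec A. \<forall>s'\<in>Sec A. \<forall>w\<in>V. D (s + s') w = D s w + D s' w) \<and>
     (\<forall>s\<in>Sec A. \<forall>f\<in>Cinf M. \<forall>w\<in>V. D (fscale f s) w = smul f (D s w)) \<and>
     (\<forall>s\<in>Sec A. \<forall>w\<in>V. \<forall>w'\<in>V. D s (w + w') = D s w + D s w') \<and>
     (\<forall>s\<in>Sec A. \<forall>f\<in>Cinf M. \<forall>w\<in>V.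
        D s (smul f w) = smul (deriv_along (app \<rho> s) f) w + smul f (D s w))"

definition algebroid_representation ::
    "'m mfd \<Rightarrow> ('m, 'v::real_vector) ivbundle \<Rightarrow> ('m \<Rightarrow> 'v \<Rightarrow> 'm tvec) \<Rightarrow>
     (('m \<Rightarrow> 'v) \<Rightarrow> ('m \<Rightarrow> 'v) \<Rightarrow> 'm \<Rightarrow> 'v) \<Rightarrow>
     'w::ab_group_add set \<Rightarrow> (('m \<Rightarrow> real) \<Rightarrow> 'w \<Rightarrow> 'w) \<Rightarrow> (('m \<Rightarrow> 'v) \<Rightarrow> 'w \<Rightarrow> 'w) \<Rightarrow> bool" where
  "algebroid_representation M A \<rho> br V smul D \<longleftrightarrow>
     module_connection M A \<rho> V smul D \<and>
     (\<forall>s\<in>Sec A. \<forall>s'\<in>Sec A. \<forall>w\<in>V. D (br s s') w = D s (D s' w) - D s' (D s w))"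

definition tensor_scale :: "('m \<Rightarrow> real) \<Rightarrow> 'm tensor \<Rightarrow> 'm tensor" where
  "tensor_scale f t = (\<lambda>\<alpha> X. fscale f (t \<alpha> X))"

definition invariant ::
    "('m, 'v) ivbundle \<Rightarrow> (('m \<Rightarrow> 'v) \<Rightarrow> 'w::zero \<Rightarrow> 'w) \<Rightarrow> 'w \<Rightarrow> bool" where
  "invariant A D w \<longleftrightarrow> (\<forall>s\<in>Sec A. D s w = 0)"

section \<open>The Leibniz rules on decomposable tensors\<close>

lemma eventually_upd_in_open:
  assumes "openin (Euclidean_space n) V" "x \<in> V" "i < n"
  shows "\<forall>\<^sub>F t in nhds (x i). x(i := t) \<in> V"
proof -
  from assms(1) obtain T where T: "openin (powertop_real UNIV) T"
    and V: "V = T \<inter> {x. \<forall>i\<ge>n. x i = 0}"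
    unfolding Euclidean_space_def openin_subtopology by blast
  have oT: "open T"
    using T by (simp add: euclidean_product_topology)
  have "continuous_on UNIV (\<lambda>t. x(i := t))"
  proof (rule continuous_on_coordinatewise_then_product)
    show "continuous_on UNIV (\<lambda>t. (x(i := t)) j)" for j
      by (cases "j = i") auto
  qed
  then have "open ((\<lambda>t. x(i := t)) -` T)"
    using oT by (simp add: continuous_on_open_vimage)
  moreover have "x i \<in> (\<lambda>t. x(i := t)) -` T"
    using assms(2) V by auto
  ultimately have "\<forall>\<^sub>F t in nhds (x i). t \<in> (\<lambda>t. x(i := t)) -` T"
    by (rule eventually_nhds_in_open)
  then show ?thesis
  proof (rule eventually_mono)
    fix t assume "t \<in> (\<lambda>t. x(i := t)) -` T"
    moreover have "\<forall>j\<ge>n. (x(i := t)) j = 0"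
      using assms(2,3) V by auto
    ultimately show "x(i := t) \<in> V" using V by auto
  qed
qed

lemma Ck_on_cong:
  assumes "openin (Euclidean_space n) V" "\<And>x. x \<in> V \<Longrightarrow> f x = g x" "Ck_on n V k f"
  shows "Ck_on n V k g"
  using assms(2,3)
proof (induction k arbitrary: f g)
  case 0
  then show ?case by (auto cong: continuous_on_cong)
next
  case (Suc k)
  have c: "continuous_on V g"
    using Suc.prems by (auto cong: continuous_on_cong)
  have ev: "\<forall>\<^sub>F t in nhds (x i). f (x(i := t)) = g (x(i := t))" if "i < n" "x \<in> V" for i x
    using eventually_upd_in_open[OF assms(1) that(2) that(1)]
    by (rule eventually_mono) (use Suc.prems in auto)
  have d: "(\<lambda>t. g (x(i := t))) differentiable (at (x i))" if "i < n" "x \<in> V" for i x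
  proof -
    have "(\<lambda>t. f (x(i := t))) differentiable (at (x i))"
      using Suc.prems(2) that by auto
    then obtain D where "((\<lambda>t. f (x(i := t))) has_real_derivative D) (at (x i))"
      using real_differentiable_def by blast
    then have "((\<lambda>t. g (x(i := t))) has_real_derivative D) (at (x i))"
      using DERIV_cong_ev[OF refl ev[OF that] refl] by blast
    then show ?thesis using real_differentiable_def by blast
  qed
  have p: "partial_deriv i f x = partial_deriv i g x" if "i < n" "x \<in> V" for i x
    unfolding partial_deriv_def by (rule deriv_cong_ev[OF ev[OF that] refl])
  have "Ck_on n V k (partial_deriv i g)" if "i < n" for i
    using Suc.IH[of "partial_deriv i f" "partial_deriv i g"] p that Suc.prems(2) by auto
  then show ?case using c d by simp
qed

lemma Ck_on_Suc_D: "Ck_on n V (Suc k) f \<Longrightarrow> Ck_on n V k f"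
proof (induction k arbitrary: f)
  case 0
  then show ?case by simp
next
  case (Suc k)
  have "Ck_on n V k (partial_deriv i f)" if "i < n" for i
    using Suc.prems that by (intro Suc.IH) auto
  then show ?case using Suc.prems by simp
qed

lemma Ck_on_const: "Ck_on n V k (\<lambda>x. c)"
proof (induction k arbitrary: c)
  case (Suc k)
  have "partial_deriv i (\<lambda>x. c) = (\<lambda>x. 0)" for i
    by (simp add: partial_deriv_def fun_eq_iff)
  then show ?case using Suc by simp
qed simp

lemma Ck_on_add:
  assumes V: "openin (Euclidean_space n) V"
  shows "Ck_on n V k f \<Longrightarrow> Ck_on n V k g \<Longrightarrow> Ck_on n V k (\<lambda>x. f x + g x)"
proof (induction k arbitrary: f g)
  case 0
  then show ?case by (auto intro: continuous_on_add)
next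
  case (Suc k)
  have "partial_deriv i f x + partial_deriv i g x = partial_deriv i (\<lambda>x. f x + g x) x"
    if "i < n" "x \<in> V" for i x
    using Suc.prems that unfolding partial_deriv_def
    by (simp add: field_differentiable_def real_differentiable_def)
  moreover have "Ck_on n V k (\<lambda>x. partial_deriv i f x + partial_deriv i g x)" if "i < n" for i
    using Suc.prems that by (intro Suc.IH) auto
  ultimately have "Ck_on n V k (partial_deriv i (\<lambda>x. f x + g x))" if "i < n" for i
    using Ck_on_cong[OF V, of "\<lambda>x. partial_deriv i f x + partial_deriv i g x"
        "partial_deriv i (\<lambda>x. f x + g x)" k] that by blast
  then show ?case
    using Suc.prems by (auto intro: continuous_on_add differentiable_add)
qed

lemma Ck_on_mult:
  assumes V: "openin (Euclidean_space n) V"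
  shows "Ck_on n V k f \<Longrightarrow> Ck_on n V k g \<Longrightarrow> Ck_on n V k (\<lambda>x. f x * g x)"
proof (induction k arbitrary: f g)
  case 0
  then show ?case by (auto intro: continuous_on_mult)
next
  case (Suc k)
  have p: "f x * partial_deriv i g x + partial_deriv i f x * g x = partial_deriv i (\<lambda>x. f x * g x) x"
    if "i < n" "x \<in> V" for i x
    using Suc.prems that unfolding partial_deriv_def
    by (simp add: field_differentiable_def real_differentiable_def)
  have "Ck_on n V k (\<lambda>x. f x * partial_deriv i g x + partial_deriv i f x * g x)" if "i < n" for i
  proof -
    have "Ck_on n V k (partial_deriv i f)" "Ck_on n V k (partial_deriv i g)"
      using Suc.prems that by auto
    moreover have "Ck_on n V k f" "Ck_on n V k g"
      using Suc.prems Ck_on_Suc_D by blast+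
    ultimately show ?thesis by (simp add: Ck_on_add[OF V] Suc.IH)
  qed
  then have "Ck_on n V k (partial_deriv i (\<lambda>x. f x * g x))" if "i < n" for i
    using Ck_on_cong[OF V, of "\<lambda>x. f x * partial_deriv i g x + partial_deriv i f x * g x"
        "partial_deriv i (\<lambda>x. f x * g x)" k] p that by blast
  then show ?case
    using Suc.prems by (auto intro: continuous_on_mult differentiable_mult)
qed

lemma sum_fun_apply: "(\<Sum>i\<in>I. f i) x = (\<Sum>i\<in>I. f i x)"
  by (induction I rule: infinite_finite_induct) auto

lemma openin_chart_image:
  assumes "smooth_manifold M" "(U, \<phi>) \<in> charts M"
  shows "openin (Euclidean_space (mdim M)) (\<phi> ` U)"
  using assms unfolding smooth_manifold_def by blast

text \<open>The decomposable tensor whose \<open>i\<close>-th factor is the vector field \<open>w i\<close> or the 1-form \<open>\<theta> i\<close>.\<close>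

definition tensor_product ::
    "'m mfd \<Rightarrow> variance list \<Rightarrow> (nat \<Rightarrow> 'm \<Rightarrow> 'm tvec) \<Rightarrow> (nat \<Rightarrow> 'm form) \<Rightarrow> 'm tensor" where
  "tensor_product M \<kappa> w \<theta> = (\<lambda>\<alpha> X. if tensor_args M \<kappa> \<alpha> X
     then (\<lambda>p. \<Prod>i<length \<kappa>. case \<kappa> ! i of Contra \<Rightarrow> \<alpha> i (w i) p | Co \<Rightarrow> \<theta> i (X i) p) else 0)"

context
  fixes M :: "'m::{t2_space,second_countable_topology} mfd"
  assumes M: "smooth_manifold M"
begin

lemma Cinf_const: "(\<lambda>x. c) \<in> Cinf M"
  by (auto simp: Cinf_def smooth_on_def Cinf_on_def Ck_on_const)

lemma Cinf_add: "f \<in> Cinf M \<Longrightarrow> g \<in> Cinf M \<Longrightarrow> (\<lambda>x. f x + g x) \<in> Cinf M"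
  using openin_chart_image[OF M]
  by (auto simp: Cinf_def smooth_on_def Cinf_on_def intro!: Ck_on_add)

lemma Cinf_mult: "f \<in> Cinf M \<Longrightarrow> g \<in> Cinf M \<Longrightarrow> (\<lambda>x. f x * g x) \<in> Cinf M"
  using openin_chart_image[OF M]
  by (auto simp: Cinf_def smooth_on_def Cinf_on_def intro!: Ck_on_mult)

lemma Cinf_lin: "f \<in> Cinf M \<Longrightarrow> g \<in> Cinf M \<Longrightarrow> (\<lambda>x. a * f x + b * g x) \<in> Cinf M"
  by (intro Cinf_add Cinf_mult Cinf_const)

lemma Cinf_diff: "f \<in> Cinf M \<Longrightarrow> g \<in> Cinf M \<Longrightarrow> (\<lambda>x. f x - g x) \<in> Cinf M"
  using Cinf_lin[of f g 1 "-1"] by simp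

lemma Cinf_prod:
  assumes "finite I" "\<And>i. i \<in> I \<Longrightarrow> f i \<in> Cinf M"
  shows "(\<lambda>x. \<Prod>i\<in>I. f i x) \<in> Cinf M"
  using assms by (induction I rule: finite_induct) (auto intro: Cinf_const Cinf_mult)

lemma vfields_iff:
  "X \<in> vfields M \<longleftrightarrow>
     (\<forall>p. X p \<in> tangent_space M p) \<and> (\<forall>f\<in>Cinf M. deriv_along X f \<in> Cinf M)"
  by (auto simp: vfields_def Sec_def tangent_bundle_def Cinf_def)

lemma vfield_lin:
  "X \<in> vfields M \<Longrightarrow> f \<in> Cinf M \<Longrightarrow> g \<in> Cinf M \<Longrightarrow>
   X p (\<lambda>x. a * f x + b * g x) = a * X p f + b * X p g"
  by (auto simp: vfields_iff tangent_space_def)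

lemma vfield_diff:
  "X \<in> vfields M \<Longrightarrow> f \<in> Cinf M \<Longrightarrow> g \<in> Cinf M \<Longrightarrow> X p (\<lambda>x. f x - g x) = X p f - X p g"
  using vfield_lin[of X f g p 1 "-1"] by simp

lemma vfield_mult:
  "X \<in> vfields M \<Longrightarrow> f \<in> Cinf M \<Longrightarrow> g \<in> Cinf M \<Longrightarrow>
   X p (\<lambda>x. f x * g x) = X p f * g p + f p * X p g"
  by (auto simp: vfields_iff tangent_space_def)

lemma vfield_const:
  assumes "X \<in> vfields M"
  shows "X p (\<lambda>x. c) = 0"
  using vfield_lin[OF assms Cinf_const Cinf_const, of p c c 1 1]
    vfield_mult[OF assms Cinf_const Cinf_const, of p 1 1]
    vfield_lin[OF assms Cinf_const Cinf_const, of p c 1 0 1] by simp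

lemma vfield_prod:
  assumes X: "X \<in> vfields M" and "finite I" "\<And>i. i \<in> I \<Longrightarrow> f i \<in> Cinf M"
  shows "X p (\<lambda>x. \<Prod>i\<in>I. f i x) = (\<Sum>i\<in>I. X p (f i) * (\<Prod>j\<in>I - {i}. f j p))"
  using assms(2,3)
proof (induction I rule: finite_induct)
  case empty
  then show ?case using vfield_const[OF X] by simp
next
  case (insert a I)
  have "(\<Sum>i\<in>I. X p (f i) * (\<Prod>j\<in>insert a I - {i}. f j p)) =
        (\<Sum>i\<in>I. f a p * (X p (f i) * (\<Prod>j\<in>I - {i}. f j p)))"
  proof (rule sum.cong[OF refl])
    fix i assume i: "i \<in> I"
    then have "insert a I - {i} = insert a (I - {i})" using insert.hyps by auto
    then show "X p (f i) * (\<Prod>j\<in>insert a I - {i}. f j p) =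
        f a p * (X p (f i) * (\<Prod>j\<in>I - {i}. f j p))"
      using insert.hyps by simp
  qed
  moreover have "insert a I - {a} = I" using insert.hyps by auto
  ultimately show ?case
    using insert vfield_mult[OF X, of "f a" "\<lambda>x. \<Prod>i\<in>I. f i x" p] Cinf_prod[of I f]
    by (simp add: sum_distrib_left)
qed

lemma vfields_add:
  assumes "X \<in> vfields M" "Y \<in> vfields M"
  shows "X + Y \<in> vfields M"
proof -
  have "deriv_along (X + Y) f = (\<lambda>p. deriv_along X f p + deriv_along Y f p)" for f
    by (simp add: deriv_along_def fun_eq_iff)
  then show ?thesis
    using assms by (auto simp: vfields_iff tangent_space_def algebra_simps intro!: Cinf_add)
qed

lemma vfields_lie_bracket:
  assumes X: "X \<in> vfields M" and Y: "Y \<in> vfields M"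
  shows "lie_bracket X Y \<in> vfields M"
proof -
  have s: "deriv_along X f \<in> Cinf M" "deriv_along Y f \<in> Cinf M" if "f \<in> Cinf M" for f
    using assms that by (auto simp: vfields_iff)
  have "deriv_along (lie_bracket X Y) f =
        (\<lambda>p. deriv_along X (deriv_along Y f) p - deriv_along Y (deriv_along X f) p)" for f
    by (simp add: deriv_along_def lie_bracket_def fun_eq_iff)
  then have "deriv_along (lie_bracket X Y) f \<in> Cinf M" if "f \<in> Cinf M" for f
    using s that by (auto intro!: Cinf_diff)
  moreover have "lie_bracket X Y p \<in> tangent_space M p" for p
  proof -
    have l: "deriv_along Z (\<lambda>x. a * f x + b * g x) =
             (\<lambda>x. a * deriv_along Z f x + b * deriv_along Z g x)"
      if "Z \<in> vfields M" "f \<in> Cinf M" "g \<in> Cinf M" for Z a b f g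
      using vfield_lin[OF that] by (simp add: deriv_along_def)
    have m: "deriv_along Z (\<lambda>x. f x * g x) =
             (\<lambda>x. 1 * (deriv_along Z f x * g x) + 1 * (f x * deriv_along Z g x))"
      if "Z \<in> vfields M" "f \<in> Cinf M" "g \<in> Cinf M" for Z f g
      using vfield_mult[OF that] by (simp add: deriv_along_def)
    have z: "deriv_along Z f = (\<lambda>x. 0)" if "Z \<in> vfields M" "f \<notin> Cinf M" for Z f
      using that by (auto simp: vfields_iff tangent_space_def deriv_along_def)
    have "lie_bracket X Y p (\<lambda>x. a * f x + b * g x) =
          a * lie_bracket X Y p f + b * lie_bracket X Y p g"
      if "f \<in> Cinf M" "g \<in> Cinf M" for f g a b
      using that s X Y by (simp add: lie_bracket_def l vfield_lin algebra_simps)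
    moreover have "lie_bracket X Y p (\<lambda>x. f x * g x) =
          lie_bracket X Y p f * g p + f p * lie_bracket X Y p g"
      if fg: "f \<in> Cinf M" "g \<in> Cinf M" for f g
    proof -
      have e: "Z p (deriv_along Z' (\<lambda>x. f x * g x)) =
          Z p (deriv_along Z' f) * g p + Z' p f * Z p g +
          (Z p f * Z' p g + f p * Z p (deriv_along Z' g))"
        if Z: "Z \<in> vfields M" "Z' \<in> vfields M" for Z Z'
      proof -
        have s': "deriv_along Z' f \<in> Cinf M" "deriv_along Z' g \<in> Cinf M"
          using Z fg by (auto simp: vfields_iff)
        show ?thesis
          unfolding m[OF Z(2) fg] vfield_lin[OF Z(1) Cinf_mult[OF s'(1) fg(2)] Cinf_mult[OF fg(1) s'(2)]]
            vfield_mult[OF Z(1) s'(1) fg(2)] vfield_mult[OF Z(1) fg(1) s'(2)]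
          by (simp add: deriv_along_def)
      qed
      show ?thesis
        unfolding lie_bracket_def e[OF X Y] e[OF Y X] by (simp add: algebra_simps)
    qed
    moreover have "lie_bracket X Y p f = 0" if "f \<notin> Cinf M" for f
      using z that X Y vfield_const[OF X] vfield_const[OF Y] by (simp add: lie_bracket_def)
    ultimately show ?thesis by (auto simp: tangent_space_def)
  qed
  ultimately show ?thesis by (auto simp: vfields_iff)
qed

lemma bundle_map_Sec:
  assumes "bundle_map E F \<phi>" "s \<in> Sec E"
  shows "app \<phi> s \<in> Sec F"
proof -
  obtain d where "s \<in> sections_on (E d) UNIV" using assms(2) by (auto simp: Sec_def)
  moreover obtain d' where
    "\<forall>U s. open U \<longrightarrow> s \<in> sections_on (E d) U \<longrightarrow> app \<phi> s \<in> sections_on (F d') U"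
    using assms(1) unfolding bundle_map_def by blast
  ultimately show ?thesis by (auto simp: Sec_def)
qed

lemma vfields_anchor:
  "anchored_bundle M E \<rho> \<Longrightarrow> s \<in> Sec E \<Longrightarrow> app \<rho> s \<in> vfields M"
  unfolding anchored_bundle_def vfields_def using bundle_map_Sec by blast

lemma vfields_Econn_TM:
  assumes "anchored_bundle M E \<rho>" "connection M E nab" "s \<in> Sec E" "v \<in> vfields M"
  shows "Econn_TM \<rho> nab s v \<in> vfields M"
proof -
  have "nab s v \<in> Sec E"
    using assms by (auto simp: connection_def vforms_def)
  then show ?thesis
    unfolding Econn_TM_def using assms
    by (intro vfields_add vfields_lie_bracket vfields_anchor)
qed

text \<open>\<open>L_s(\<omega> \<otimes> s') = L_{\<rho>(s)} \<omega> \<otimes> s' + \<omega> \<otimes> [s, s']\<close>\<close>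

lemma lie_deriv_vform_tensor:
  assumes "lie_algebroid M A \<rho> br" "s \<in> Sec A" "s' \<in> Sec A" "\<omega> \<in> one_forms M" "v \<in> vfields M"
  shows "lie_deriv_vform \<rho> br s (\<lambda>v. fscale (\<omega> v) s') v =
    fscale (deriv_along (app \<rho> s) (\<omega> v) - \<omega> (lie_bracket (app \<rho> s) v)) s' + fscale (\<omega> v) (br s s')"
proof -
  have "\<omega> v \<in> Cinf M" using assms(4,5) by (auto simp: one_forms_def vforms_def)
  then have "br s (fscale (\<omega> v) s') =
      fscale (\<omega> v) (br s s') + fscale (deriv_along (app \<rho> s) (\<omega> v)) s'"
    using assms(1-3) unfolding lie_algebroid_def by blast
  then show ?thesis
    by (simp add: lie_deriv_vform_def fscale_def fun_eq_iff algebra_simps)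
qed

lemma fibre_mono:
  assumes "ivector_bundle M E" "d \<le> d'"
  shows "fibre (E d) p \<subseteq> fibre (E d') p"
  using assms(2)
proof (induction d' rule: dec_induct)
  case (step n)
  then show ?case using assms(1) unfolding ivector_bundle_def by blast
qed simp

lemma section_in_fibre:
  assumes "vector_bundle M B" "s \<in> sections_on B UNIV"
  shows "s p \<in> fibre B p"
proof -
  note vb = assms(1)[unfolded vector_bundle_def]
  obtain U k e where U: "p \<in> U" "local_frame M B U k e"
    using vb[THEN conjunct2, THEN conjunct2, THEN conjunct2] by metis
  then have oU: "open U" by (simp add: local_frame_def)
  have "s \<in> sections_on B U"
    using vb[THEN conjunct2, THEN conjunct1, rule_format, of UNIV U s] assms(2) oU by simp
  then obtain c where "s p = (\<Sum>i<k. c i p *\<^sub>R e i p)"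
    using U oU unfolding local_frame_def by blast
  moreover have "e i p \<in> fibre B p" if "i < k" for i
    using U that unfolding local_frame_def by (metis (no_types, lifting) imageI lessThan_iff span_base)
  moreover have "subspace (fibre B p)"
    using assms(1) by (simp add: vector_bundle_def)
  ultimately show ?thesis
    by (auto intro!: subspace_sum subspace_scale)
qed

lemma app_anchor_lin:
  assumes E: "anchored_bundle M E \<rho>" and s: "s \<in> Sec E" "s' \<in> Sec E"
  shows "app \<rho> (fscale f s + fscale g s') = fscale f (app \<rho> s) + fscale g (app \<rho> s')"
proof
  fix p
  have iv: "ivector_bundle M E" and bm: "bundle_map E (tangent_bundle M) \<rho>"
    using E by (auto simp: anchored_bundle_def)
  obtain d d' where d: "s \<in> sections_on (E d) UNIV" "s' \<in> sections_on (E d') UNIV"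
    using s by (auto simp: Sec_def)
  have v: "vector_bundle M (E d)" "vector_bundle M (E d')"
    using iv by (auto simp: ivector_bundle_def)
  have "s p \<in> fibre (E (max d d')) p" "s' p \<in> fibre (E (max d d')) p"
    using section_in_fibre[OF v(1) d(1)] section_in_fibre[OF v(2) d(2)]
      fibre_mono[OF iv, of d "max d d'"] fibre_mono[OF iv, of d' "max d d'"] by force+
  then have "\<rho> p (f p *\<^sub>R s p + g p *\<^sub>R s' p) = f p *\<^sub>R \<rho> p (s p) + g p *\<^sub>R \<rho> p (s' p)"
    using bm unfolding bundle_map_def by blast
  then show "app \<rho> (fscale f s + fscale g s') p = (fscale f (app \<rho> s) + fscale g (app \<rho> s')) p"
    by (simp add: app_def fscale_def)
qed

lemma vfields_fscale:
  assumes f: "f \<in> Cinf M" and X: "X \<in> vfields M"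
  shows "fscale f X \<in> vfields M"
proof -
  have "deriv_along (fscale f X) h = (\<lambda>p. f p * deriv_along X h p)" for h
    by (simp add: deriv_along_def fscale_def scaleR_fun_def fun_eq_iff)
  then show ?thesis
    using assms by (auto simp: vfields_iff tangent_space_def fscale_def scaleR_fun_def
        algebra_simps intro!: Cinf_mult)
qed

lemma lie_bracket_lin:
  assumes Z: "Z \<in> vfields M" and v: "v \<in> vfields M" "w \<in> vfields M"
    and f: "f \<in> Cinf M" "g \<in> Cinf M"
  shows "lie_bracket Z (fscale f v + fscale g w) =
    fscale f (lie_bracket Z v) + fscale g (lie_bracket Z w) +
    (fscale (deriv_along Z f) v + fscale (deriv_along Z g) w)"
proof (intro ext)
  fix p h
  let ?u = "fscale f v + fscale g w"
  have u: "?u \<in> vfields M"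
    by (intro vfields_add vfields_fscale v f)
  show "lie_bracket Z ?u p h =
    (fscale f (lie_bracket Z v) + fscale g (lie_bracket Z w) +
    (fscale (deriv_along Z f) v + fscale (deriv_along Z g) w)) p h"
  proof (cases "h \<in> Cinf M")
    case True
    have D: "deriv_along v h \<in> Cinf M" "deriv_along w h \<in> Cinf M"
      using v True by (auto simp: vfields_iff)
    have "deriv_along ?u h = (\<lambda>x. 1 * (f x * deriv_along v h x) + 1 * (g x * deriv_along w h x))"
      by (simp add: deriv_along_def fscale_def scaleR_fun_def fun_eq_iff)
    then have "Z p (deriv_along ?u h) = 1 * (Z p f * v p h + f p * Z p (deriv_along v h)) +
        1 * (Z p g * w p h + g p * Z p (deriv_along w h))"
      using vfield_lin[OF Z Cinf_mult[OF f(1) D(1)] Cinf_mult[OF f(2) D(2)], of p 1 1]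
        vfield_mult[OF Z f(1) D(1)] vfield_mult[OF Z f(2) D(2)]
      by (simp add: deriv_along_def)
    then show ?thesis
      by (simp add: lie_bracket_def fscale_def scaleR_fun_def deriv_along_def algebra_simps)
  next
    case False
    have z: "V q h = 0" if "V \<in> vfields M" for V q
      using that False by (auto simp: vfields_iff tangent_space_def)
    show ?thesis
      unfolding z[OF vfields_lie_bracket[OF Z u]]
      by (simp add: fscale_def scaleR_fun_def z[OF v(1)] z[OF v(2)]
          z[OF vfields_lie_bracket[OF Z v(1)]] z[OF vfields_lie_bracket[OF Z v(2)]])
  qed
qed

lemma Econn_TM_lin:
  assumes E: "anchored_bundle M E \<rho>" and nab: "connection M E nab" and s: "s \<in> Sec E"
    and v: "v \<in> vfields M" "w \<in> vfields M" and f: "f \<in> Cinf M" "g \<in> Cinf M"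
  shows "Econn_TM \<rho> nab s (fscale f v + fscale g w) =
    fscale f (Econn_TM \<rho> nab s v) + fscale g (Econn_TM \<rho> nab s w) +
    (fscale (deriv_along (app \<rho> s) f) v + fscale (deriv_along (app \<rho> s) g) w)"
proof -
  have n: "nab s (fscale f v + fscale g w) = fscale f (nab s v) + fscale g (nab s w)"
    "nab s v \<in> Sec E" "nab s w \<in> Sec E"
    using nab s v f by (auto simp: connection_def vforms_def)
  show ?thesis
    unfolding Econn_TM_def n(1) app_anchor_lin[OF E n(2,3)]
      lie_bracket_lin[OF vfields_anchor[OF E s] v f]
    by (simp add: fscale_def fun_eq_iff algebra_simps scaleR_fun_def)
qed

lemma one_form_lin:
  assumes "\<omega> \<in> one_forms M" "v \<in> vfields M" "w \<in> vfields M" "f \<in> Cinf M" "g \<in> Cinf M"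
  shows "\<omega> (fscale f v + fscale g w) = fscale f (\<omega> v) + fscale g (\<omega> w)"
  using assms by (auto simp: one_forms_def vforms_def)

lemma one_form_add:
  assumes "\<omega> \<in> one_forms M" "v \<in> vfields M" "w \<in> vfields M"
  shows "\<omega> (v + w) = \<omega> v + \<omega> w"
  using one_form_lin[OF assms Cinf_const[of 1] Cinf_const[of 1]] by (simp add: fscale_def)

lemma one_form_Cinf: "\<omega> \<in> one_forms M \<Longrightarrow> v \<in> vfields M \<Longrightarrow> \<omega> v \<in> Cinf M"
  by (auto simp: one_forms_def vforms_def)

lemma one_forms_Econn_T'M:
  assumes E: "anchored_bundle M E \<rho>" and nab: "connection M E nab" and s: "s \<in> Sec E"
    and \<omega>: "\<omega> \<in> one_forms M"
  shows "Econn_T'M M \<rho> nab s \<omega> \<in> one_forms M"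
proof -
  let ?Z = "app \<rho> s" and ?E = "Econn_TM \<rho> nab s"
  have Z: "?Z \<in> vfields M" by (rule vfields_anchor[OF E s])
  have EM: "?E v \<in> vfields M" if "v \<in> vfields M" for v
    by (rule vfields_Econn_TM[OF E nab s that])
  have ZC: "deriv_along ?Z f \<in> Cinf M" if "f \<in> Cinf M" for f
    using Z that by (auto simp: vfields_iff)
  have "deriv_along ?Z (\<omega> v) - \<omega> (?E v) \<in> Cinf M" if "v \<in> vfields M" for v
    using Cinf_diff[OF ZC[OF one_form_Cinf[OF \<omega> that]] one_form_Cinf[OF \<omega> EM[OF that]]]
    by (simp add: fun_diff_def)
  moreover have "deriv_along ?Z (\<omega> (fscale f v + fscale g w)) - \<omega> (?E (fscale f v + fscale g w)) =
      fscale f (deriv_along ?Z (\<omega> v) - \<omega> (?E v)) + fscale g (deriv_along ?Z (\<omega> w) - \<omega> (?E w))"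
    if v: "v \<in> vfields M" "w \<in> vfields M" and f: "f \<in> Cinf M" "g \<in> Cinf M" for v w f g
  proof -
    have 1: "\<omega> (?E (fscale f v + fscale g w)) =
        fscale f (\<omega> (?E v)) + fscale g (\<omega> (?E w)) +
        (fscale (deriv_along ?Z f) (\<omega> v) + fscale (deriv_along ?Z g) (\<omega> w))"
      unfolding Econn_TM_lin[OF E nab s v f]
        one_form_add[OF \<omega> vfields_add[OF vfields_fscale[OF f(1) EM[OF v(1)]]
            vfields_fscale[OF f(2) EM[OF v(2)]]]
          vfields_add[OF vfields_fscale[OF ZC[OF f(1)] v(1)] vfields_fscale[OF ZC[OF f(2)] v(2)]]]
        one_form_lin[OF \<omega> EM[OF v(1)] EM[OF v(2)] f]
        one_form_lin[OF \<omega> v ZC[OF f(1)] ZC[OF f(2)]] ..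
    have 2: "\<omega> (fscale f v + fscale g w) = (\<lambda>x. 1 * (f x * \<omega> v x) + 1 * (g x * \<omega> w x))"
      unfolding one_form_lin[OF \<omega> v f] by (simp add: fscale_def fun_eq_iff)
    have c: "\<omega> v \<in> Cinf M" "\<omega> w \<in> Cinf M" using one_form_Cinf[OF \<omega>] v by auto
    have 3: "deriv_along ?Z (\<omega> (fscale f v + fscale g w)) = (\<lambda>p.
        1 * (?Z p f * \<omega> v p + f p * ?Z p (\<omega> v)) + 1 * (?Z p g * \<omega> w p + g p * ?Z p (\<omega> w)))"
      unfolding 2 deriv_along_def vfield_lin[OF Z Cinf_mult[OF f(1) c(1)] Cinf_mult[OF f(2) c(2)]]
        vfield_mult[OF Z f(1) c(1)] vfield_mult[OF Z f(2) c(2)] ..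
    show ?thesis
      unfolding 1 3 by (simp add: fscale_def deriv_along_def fun_eq_iff algebra_simps)
  qed
  moreover have "fscale f v + fscale g w \<in> vfields M"
    if "v \<in> vfields M" "w \<in> vfields M" "f \<in> Cinf M" "g \<in> Cinf M" for v w f g
    using that by (intro vfields_add vfields_fscale)
  ultimately show ?thesis
    by (simp add: one_forms_def vforms_def Econn_T'M_def)
qed

lemma tensor_args_upd:
  assumes "tensor_args M \<kappa> \<alpha> X"
  shows "\<beta> \<in> one_forms M \<Longrightarrow> tensor_args M \<kappa> (\<alpha>(i := \<beta>)) X"
    and "v \<in> vfields M \<Longrightarrow> tensor_args M \<kappa> \<alpha> (X(i := v))"
  using assms by (auto simp: tensor_args_def split: variance.splits)

lemma Econn_comb_tensor_product:
  assumes E: "anchored_bundle M E \<rho>" and nab: "\<And>i. i < length \<kappa> \<Longrightarrow> connection M E (nab i)"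
    and s: "s \<in> Sec E"
    and w: "\<And>i. i < length \<kappa> \<Longrightarrow> \<kappa> ! i = Contra \<Longrightarrow> w i \<in> vfields M"
    and \<theta>: "\<And>i. i < length \<kappa> \<Longrightarrow> \<kappa> ! i = Co \<Longrightarrow> \<theta> i \<in> one_forms M"
  shows "Econn_comb M \<rho> \<kappa> nab s (tensor_product M \<kappa> w \<theta>) =
    (\<Sum>i<length \<kappa>. case \<kappa> ! i of
        Contra \<Rightarrow> tensor_product M \<kappa> (w(i := Econn_TM \<rho> (nab i) s (w i))) \<theta>
      | Co \<Rightarrow> tensor_product M \<kappa> w (\<theta>(i := Econn_T'M M \<rho> (nab i) s (\<theta> i))))"
proof (intro ext)
  fix \<alpha> X p
  let ?T = "tensor_product M \<kappa>" and ?Z = "app \<rho> s"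
  let ?ET = "\<lambda>i. Econn_TM \<rho> (nab i) s" and ?E' = "\<lambda>i. Econn_T'M M \<rho> (nab i) s"
  let ?R = "\<lambda>i. case \<kappa> ! i of Contra \<Rightarrow> ?T (w(i := ?ET i (w i))) \<theta> | Co \<Rightarrow> ?T w (\<theta>(i := ?E' i (\<theta> i)))"
  have R: "(\<Sum>i<length \<kappa>. ?R i) \<alpha> X p = (\<Sum>i<length \<kappa>. ?R i \<alpha> X p)"
    by (simp add: sum_fun_apply)
  show "Econn_comb M \<rho> \<kappa> nab s (?T w \<theta>) \<alpha> X p = (\<Sum>i<length \<kappa>. ?R i) \<alpha> X p"
  proof (cases "tensor_args M \<kappa> \<alpha> X")
    case False
    then have "?R i \<alpha> X p = 0" for i
      by (simp add: tensor_product_def split: variance.splits)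
    then show ?thesis unfolding R using False by (simp add: Econn_comb_def)
  next
    case True
    define I where "I = {..<length \<kappa>}"
    have fin: "finite I" by (simp add: I_def)
    define g where "g i = (case \<kappa> ! i of Contra \<Rightarrow> \<alpha> i (w i) | Co \<Rightarrow> \<theta> i (X i))" for i
    define h where "h i = (case \<kappa> ! i of Contra \<Rightarrow> \<alpha> i (?ET i (w i)) p | Co \<Rightarrow> ?E' i (\<theta> i) (X i) p)" for i
    define k where "k i = (case \<kappa> ! i of Contra \<Rightarrow> ?E' i (\<alpha> i) (w i) p | Co \<Rightarrow> \<theta> i (?ET i (X i)) p)" for i
    have A: "\<alpha> i \<in> one_forms M" if "i \<in> I" "\<kappa> ! i = Contra" for i
      using True that by (auto simp: tensor_args_def I_def split: variance.splits)
    have B: "X i \<in> vfields M" if "i \<in> I" "\<kappa> ! i = Co" for i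
      using True that by (auto simp: tensor_args_def I_def split: variance.splits)
    have g: "g i \<in> Cinf M" if "i \<in> I" for i
      using that A B w \<theta> one_form_Cinf by (auto simp: g_def I_def split: variance.splits)
    have hk: "h i = ?Z p (g i) - k i" if "i \<in> I" for i
      using that B w by (auto simp: g_def h_def k_def I_def Econn_T'M_def deriv_along_def
          split: variance.splits)
    have P: "(\<Prod>j\<in>I. if j = i then c else g j p) = c * (\<Prod>j\<in>I - {i}. g j p)" if "i \<in> I" for i c
      using fin that by (subst prod.remove[OF fin that]) (auto intro!: prod.cong)
    have L: "?T w \<theta> \<alpha> X = (\<lambda>p. \<Prod>i\<in>I. g i p)"
      using True by (simp add: tensor_product_def g_def I_def fun_eq_iff variance.case_distrib
          if_distrib cong: variance.case_cong)
        (auto intro!: prod.cong split: variance.splits)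
    have R1: "?R i \<alpha> X p = h i * (\<Prod>j\<in>I - {i}. g j p)" if "i \<in> I" for i
    proof -
      have "?R i \<alpha> X p = (\<Prod>j\<in>I. if j = i then h i else g j p)"
        using True that unfolding tensor_product_def
        by (cases "\<kappa> ! i") (auto simp: I_def g_def h_def intro!: prod.cong split: variance.splits)
      then show ?thesis using P[OF that] by simp
    qed
    have L1: "(case \<kappa> ! i of
          Contra \<Rightarrow> ?T w \<theta> (\<alpha>(i := ?E' i (\<alpha> i))) X
        | Co \<Rightarrow> ?T w \<theta> \<alpha> (X(i := ?ET i (X i)))) p = k i * (\<Prod>j\<in>I - {i}. g j p)" if i: "i \<in> I" for i
    proof -
      have n: "connection M E (nab i)" using nab i by (simp add: I_def)
      have "(case \<kappa> ! i of
          Contra \<Rightarrow> ?T w \<theta> (\<alpha>(i := ?E' i (\<alpha> i))) X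
        | Co \<Rightarrow> ?T w \<theta> \<alpha> (X(i := ?ET i (X i)))) p = (\<Prod>j\<in>I. if j = i then k i else g j p)"
      proof (cases "\<kappa> ! i")
        case Contra
        then have "tensor_args M \<kappa> (\<alpha>(i := ?E' i (\<alpha> i))) X"
          using tensor_args_upd(1)[OF True] one_forms_Econn_T'M[OF E n s] A i by blast
        then show ?thesis
          using Contra unfolding tensor_product_def
          by (auto simp: I_def g_def k_def intro!: prod.cong split: variance.splits)
      next
        case Co
        then have "tensor_args M \<kappa> \<alpha> (X(i := ?ET i (X i)))"
          using tensor_args_upd(2)[OF True] vfields_Econn_TM[OF E n s] B i by blast
        then show ?thesis
          using Co unfolding tensor_product_def
          by (auto simp: I_def g_def k_def intro!: prod.cong split: variance.splits)
      qed
      then show ?thesis using P[OF i] by simp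
    qed
    have "Econn_comb M \<rho> \<kappa> nab s (?T w \<theta>) \<alpha> X p =
        ?Z p (\<lambda>p. \<Prod>i\<in>I. g i p) - (\<Sum>i\<in>I. k i * (\<Prod>j\<in>I - {i}. g j p))"
      using True L L1 by (simp add: Econn_comb_def deriv_along_def sum_fun_apply I_def)
    also have "\<dots> = (\<Sum>i\<in>I. ?Z p (g i) * (\<Prod>j\<in>I - {i}. g j p)) - (\<Sum>i\<in>I. k i * (\<Prod>j\<in>I - {i}. g j p))"
      using vfield_prod[OF vfields_anchor[OF E s] fin g] by simp
    also have "\<dots> = (\<Sum>i\<in>I. h i * (\<Prod>j\<in>I - {i}. g j p))"
      by (simp add: sum_subtractf[symmetric] hk left_diff_distrib)
    also have "\<dots> = (\<Sum>i\<in>I. ?R i \<alpha> X p)"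
      using R1 by simp
    finally show ?thesis unfolding R by (simp add: I_def)
  qed
qed

end

end

theory Submission
  imports Defs
begin

text \<open>
  A Cartan connection on a Lie algebroid induces flat connections on \<open>TM\<close> and \<open>T^*M\<close>, hence on all
  tensor bundles: the mixed terms in the commutator of two combined operators cancel because they act
  on different factors. So the sections \<open>s\<close> of \<open>FR(E)\<close> whose operator annihilates \<open>t\<close> are closed under
  the bracket, and they form a module over the smooth functions because the operator is
  function-linear in \<open>s\<close>. On sections of \<open>E\<close> the operators of \<open>E\<close> and \<open>FR(E)\<close> agree, and these
  sections generate.
\<close>

text \<open>Flatness on \<open>TM\<close> is the Cartan identity seen through the anchor: applying
  the anchor to the formula for \<open>nab (br s s') v\<close> turns brackets of sections into
  brackets of vector fields, and the rest is the Jacobi identity for vector fields. This requires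
  the anchor to respect brackets, which is not among the axioms of \<open>lie_algebroid\<close> and
  has to be derived from them. Flatness on the cotangent bundle then follows by duality.
  Function-linearity in \<open>s\<close> also needs an argument: neither the bracket of \<rho>(s)
  with v nor \<rho> applied to the covariant derivative is function-linear in \<open>s\<close>; only
  their sum is. Flatness and linearity hold for arbitrary Cartan connections on an arbitrary Lie
  algebroid; \<open>E\<close> enters only through the generators. Linear rules are stated with two
  smooth coefficients. Sums, differences and multiples come from the constant coefficients 1, -1 and
  0, hence the simplification rules below.\<close>

lemma fscale_const [simp]: "fscale (\<lambda>x. 1) s = s" "fscale (\<lambda>x. - 1) s = - s" "fscale (\<lambda>x. 0) s = 0"
  by (auto simp: fscale_def)

lemma fscale_zero [simp]: "fscale f 0 = 0"
  by (auto simp: fscale_def)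

lemma fscale_diff: "fscale f (s - s') = fscale f s - fscale f s'"
  by (simp add: fscale_def fun_eq_iff scaleR_right_diff_distrib)

lemma fscale_sum: "fscale f (\<Sum>i\<in>I. s i) = (\<Sum>i\<in>I. fscale f (s i))"
  by (rule ext) (simp add: fscale_def sum_fun_apply scaleR_sum_right)

lemma lie_bracket_apply: "lie_bracket X Y p f = X p (deriv_along Y f) - Y p (deriv_along X f)"
  by (simp add: lie_bracket_def)

lemma lie_bracket_swap: "lie_bracket X Y = - lie_bracket Y X"
  by (simp add: lie_bracket_def fun_eq_iff)

section \<open>Smooth sections\<close>

lemma Ck_on_subset: "Ck_on n V k f \<Longrightarrow> W \<subseteq> V \<Longrightarrow> Ck_on n W k f"
  by (induction k arbitrary: f) (auto intro: continuous_on_subset)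

lemma smooth_on_subset: "smooth_on M V f \<Longrightarrow> W \<subseteq> V \<Longrightarrow> smooth_on M W f"
  unfolding smooth_on_def Cinf_on_def by (fastforce intro: Ck_on_subset)

text \<open>The sum and product rules for \<open>Ck_on\<close> need a domain open in Euclidean
  space. Charts are homeomorphisms onto open images, so they carry open subsets of their domain to
  such sets.\<close>

lemma openin_chart_image_Int:
  assumes M: "smooth_manifold M" and "(U, \<phi>) \<in> charts M" "open W"
  shows "openin (Euclidean_space (mdim M)) (\<phi> ` (U \<inter> W))"
proof -
  have U: "openin (Euclidean_space (mdim M)) (\<phi> ` U)" "homeomorphism U (\<phi> ` U) \<phi> (inv_into U \<phi>)"
    using assms unfolding smooth_manifold_def by blast+
  have "openin (top_of_set U) (U \<inter> W)"
    using assms(3) by (simp add: openin_open_Int)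
  then have "openin (top_of_set (\<phi> ` U)) (\<phi> ` (U \<inter> W))"
    by (rule homeomorphism_imp_open_map[OF U(2)])
  with U(1) show ?thesis
    unfolding Euclidean_space_def euclidean_product_topology by (blast intro: openin_trans)
qed

lemma smooth_on_lin:
  assumes M: "smooth_manifold M" and W: "open W"
    and "smooth_on M W f" "smooth_on M W g" "smooth_on M W c" "smooth_on M W d"
  shows "smooth_on M W (\<lambda>x. f x * c x + g x * d x)"
  using assms(3-) openin_chart_image_Int[OF M _ W]
  by (auto simp: smooth_on_def Cinf_on_def intro!: Ck_on_add Ck_on_mult)

lemma sections_on_mono:
  assumes "ivector_bundle M E" "open U" "d \<le> d'"
  shows "sections_on (E d) U \<subseteq> sections_on (E d') U"
  using assms(3)
proof (induction d' rule: dec_induct)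
  case (step n)
  then show ?case using assms(1,2) unfolding ivector_bundle_def by blast
qed simp

text \<open>The definition of a vector bundle does not list closure under module operations. On the
  domain of a frame, sections are exactly the smooth combinations of the frame, where closure is
  visible in the coefficients; the sheaf condition glues.\<close>

lemma sections_on_lin:
  assumes M: "smooth_manifold M" and E: "vector_bundle M B"
    and s: "s \<in> sections_on B UNIV" "s' \<in> sections_on B UNIV" and f: "f \<in> Cinf M" "g \<in> Cinf M"
  shows "fscale f s + fscale g s' \<in> sections_on B UNIV"
proof -
  note vb = E[unfolded vector_bundle_def]
  have glue: "s \<in> sections_on B UNIV"
    if "\<And>p. \<exists>W. open W \<and> p \<in> W \<and> W \<subseteq> UNIV \<and> s \<in> sections_on B W" for s
    using vb[THEN conjunct2, THEN conjunct2, THEN conjunct1, rule_format, OF open_UNIV] that by blast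
  show ?thesis
  proof (rule glue)
    fix p
    obtain U k e where U: "p \<in> U" and lf: "local_frame M B U k e"
      using vb[THEN conjunct2, THEN conjunct2, THEN conjunct2] by metis
    then have oU: "open U" by (simp add: local_frame_def)
    note frame = lf[unfolded local_frame_def, THEN conjunct2, THEN conjunct2, rule_format, OF oU subset_refl]
    have "s \<in> sections_on B U" "s' \<in> sections_on B U"
      using vb[THEN conjunct2, THEN conjunct1, rule_format, of UNIV U] s oU by auto
    then obtain c c' where c: "\<forall>i<k. smooth_on M U (c i)" "\<forall>q\<in>U. s q = (\<Sum>i<k. c i q *\<^sub>R e i q)"
      and c': "\<forall>i<k. smooth_on M U (c' i)" "\<forall>q\<in>U. s' q = (\<Sum>i<k. c' i q *\<^sub>R e i q)"
      unfolding frame by blast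
    have fg: "smooth_on M U f" "smooth_on M U g"
      using f smooth_on_subset[of M UNIV _ U] by (auto simp: Cinf_def)
    have "fscale f s + fscale g s' \<in> sections_on B U"
      unfolding frame
    proof (intro exI conjI allI impI ballI)
      show "smooth_on M U (\<lambda>q. f q * c i q + g q * c' i q)" if "i < k" for i
        using smooth_on_lin[OF M oU fg] c(1) c'(1) that by blast
      show "(fscale f s + fscale g s') q = (\<Sum>i<k. (f q * c i q + g q * c' i q) *\<^sub>R e i q)"
        if "q \<in> U" for q
        using c(2) c'(2) that
        by (simp add: fscale_def scaleR_left_distrib sum.distrib scaleR_sum_right)
    qed
    then show "\<exists>W. open W \<and> p \<in> W \<and> W \<subseteq> UNIV \<and> fscale f s + fscale g s' \<in> sections_on B W"
      using oU U by blast
  qed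
qed

lemma Sec_lin:
  assumes M: "smooth_manifold M" and E: "ivector_bundle M E"
    and s: "s \<in> Sec E" "s' \<in> Sec E" and f: "f \<in> Cinf M" "g \<in> Cinf M"
  shows "fscale f s + fscale g s' \<in> Sec E"
proof -
  obtain d d' where "s \<in> sections_on (E d) UNIV" "s' \<in> sections_on (E d') UNIV"
    using s by (auto simp: Sec_def)
  \<comment> \<open>The two sections may come from different stages of the union; the later stage
    contains both.\<close>
  then have "s \<in> sections_on (E (max d d')) UNIV" "s' \<in> sections_on (E (max d d')) UNIV"
    using sections_on_mono[OF E open_UNIV, of d "max d d'"]
      sections_on_mono[OF E open_UNIV, of d' "max d d'"] by auto
  then have "fscale f s + fscale g s' \<in> sections_on (E (max d d')) UNIV"
    using sections_on_lin[OF M _ _ _ f] E unfolding ivector_bundle_def by blast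
  then show ?thesis by (auto simp: Sec_def)
qed

context
  fixes M :: "'m::{t2_space,second_countable_topology} mfd"
  assumes M: "smooth_manifold M"
begin

section \<open>Values and module structure of global sections\<close>

lemma Sec_in_ifibre:
  assumes "ivector_bundle M E" "s \<in> Sec E"
  shows "s p \<in> ifibre E p"
proof -
  obtain d where "s \<in> sections_on (E d) UNIV" using assms(2) by (auto simp: Sec_def)
  moreover have "vector_bundle M (E d)" using assms(1) by (simp add: ivector_bundle_def)
  ultimately have "s p \<in> fibre (E d) p" using section_in_fibre[OF M] by blast
  then show ?thesis by (auto simp: ifibre_def)
qed

lemma Sec_add: "ivector_bundle M E \<Longrightarrow> s \<in> Sec E \<Longrightarrow> s' \<in> Sec E \<Longrightarrow> s + s' \<in> Sec E"
  using Sec_lin[OF M, of E s s' "\<lambda>x. 1" "\<lambda>x. 1"] Cinf_const[OF M] by simp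

lemma Sec_diff: "ivector_bundle M E \<Longrightarrow> s \<in> Sec E \<Longrightarrow> s' \<in> Sec E \<Longrightarrow> s - s' \<in> Sec E"
  using Sec_lin[OF M, of E s s' "\<lambda>x. 1" "\<lambda>x. - 1"] Cinf_const[OF M] by simp

lemma Sec_fscale: "ivector_bundle M E \<Longrightarrow> s \<in> Sec E \<Longrightarrow> f \<in> Cinf M \<Longrightarrow> fscale f s \<in> Sec E"
  using Sec_lin[OF M, of E s s f "\<lambda>x. 0"] Cinf_const[OF M] by simp

lemma app_anchor_add:
  "anchored_bundle M E \<rho> \<Longrightarrow> s \<in> Sec E \<Longrightarrow> s' \<in> Sec E \<Longrightarrow> app \<rho> (s + s') = app \<rho> s + app \<rho> s'"
  using app_anchor_lin[OF M, of E \<rho> s s' "\<lambda>x. 1" "\<lambda>x. 1"] by simp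

lemma app_anchor_diff:
  "anchored_bundle M E \<rho> \<Longrightarrow> s \<in> Sec E \<Longrightarrow> s' \<in> Sec E \<Longrightarrow> app \<rho> (s - s') = app \<rho> s - app \<rho> s'"
  using app_anchor_lin[OF M, of E \<rho> s s' "\<lambda>x. 1" "\<lambda>x. - 1"] by simp

section \<open>Vector fields and one-forms\<close>

lemma vfield_Cinf: "X \<in> vfields M \<Longrightarrow> f \<in> Cinf M \<Longrightarrow> deriv_along X f \<in> Cinf M"
  by (auto simp: vfields_iff[OF M])

lemma deriv_along_lin:
  assumes X: "X \<in> vfields M" and f: "f \<in> Cinf M" "g \<in> Cinf M" and a: "a \<in> Cinf M" "b \<in> Cinf M"
  shows "deriv_along X (fscale f a + fscale g b) =
    (fscale f (deriv_along X a) + fscale g (deriv_along X b)) +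
    (fscale (deriv_along X f) a + fscale (deriv_along X g) b)"
proof -
  have 1: "fscale f a + fscale g b = (\<lambda>x. 1 * (f x * a x) + 1 * (g x * b x))"
    by (simp add: fscale_def fun_eq_iff)
  show ?thesis
    unfolding deriv_along_def 1 vfield_lin[OF M X Cinf_mult[OF M f(1) a(1)] Cinf_mult[OF M f(2) a(2)]]
      vfield_mult[OF M X f(1) a(1)] vfield_mult[OF M X f(2) a(2)]
    by (simp add: fscale_def fun_eq_iff)
qed

lemma deriv_along_add:
  "Z \<in> vfields M \<Longrightarrow> a \<in> Cinf M \<Longrightarrow> b \<in> Cinf M \<Longrightarrow>
    deriv_along Z (a + b) = deriv_along Z a + deriv_along Z b"
  using deriv_along_lin[OF _ Cinf_const[OF M, of 1] Cinf_const[OF M, of 1], of Z a b]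
  by (simp add: vfield_const[OF M] deriv_along_def[of _ "\<lambda>x. 1"])

lemma deriv_along_fscale:
  "Z \<in> vfields M \<Longrightarrow> f \<in> Cinf M \<Longrightarrow> a \<in> Cinf M \<Longrightarrow>
    deriv_along Z (fscale f a) = fscale (deriv_along Z f) a + fscale f (deriv_along Z a)"
  using deriv_along_lin[OF _ _ Cinf_const[OF M, of 0], of Z f a a]
  by (simp add: vfield_const[OF M] deriv_along_def[of _ "\<lambda>x. 0"])

lemma vfield_nonsmooth: "X \<in> vfields M \<Longrightarrow> f \<notin> Cinf M \<Longrightarrow> X p f = 0"
  by (auto simp: vfields_iff[OF M] tangent_space_def)

text \<open>Smoothness and the value are proved together because tangent vectors are linear only on
  smooth functions, so the induction step needs the partial sum to be smooth.\<close>

lemma vfield_sum: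
  assumes X: "X \<in> vfields M" and "finite I" "\<And>i. i \<in> I \<Longrightarrow> f i \<in> Cinf M"
  shows "(\<Sum>i\<in>I. f i) \<in> Cinf M \<and> X p (\<Sum>i\<in>I. f i) = (\<Sum>i\<in>I. X p (f i))"
  using assms(2,3)
proof (induction I rule: finite_induct)
  case empty
  then show ?case
    using vfield_const[OF M X, of p 0] Cinf_const[OF M, of 0] by (simp add: zero_fun_def)
next
  case (insert a I)
  then show ?case
    using vfield_lin[OF M X, of "f a" "\<Sum>i\<in>I. f i" p 1 1] Cinf_add[OF M, of "f a" "\<Sum>i\<in>I. f i"]
    by (simp add: plus_fun_def)
qed

lemma lie_bracket_add:
  assumes "Z \<in> vfields M" "v \<in> vfields M" "w \<in> vfields M"
  shows "lie_bracket Z (v + w) = lie_bracket Z v + lie_bracket Z w"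
  using lie_bracket_lin[OF M assms Cinf_const[OF M, of 1] Cinf_const[OF M, of 1]]
  by (simp add: vfield_const[OF M assms(1)] deriv_along_def)

text \<open>On a smooth function both sides expand into the same threefold derivatives, where
  splitting a derivative of a difference uses smoothness. On any other function all vector fields
  vanish by normalisation.\<close>

lemma lie_bracket_Jacobi:
  assumes X: "X \<in> vfields M" and Y: "Y \<in> vfields M" and Z: "Z \<in> vfields M"
  shows "lie_bracket (lie_bracket X Y) Z =
    lie_bracket X (lie_bracket Y Z) - lie_bracket Y (lie_bracket X Z)"
proof (intro ext)
  fix p and h :: "'m \<Rightarrow> real"
  have d: "deriv_along (lie_bracket V W) h =
      (\<lambda>p. deriv_along V (deriv_along W h) p - deriv_along W (deriv_along V h) p)" for V W
    by (simp add: deriv_along_def lie_bracket_def fun_eq_iff)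
  show "lie_bracket (lie_bracket X Y) Z p h =
    (lie_bracket X (lie_bracket Y Z) - lie_bracket Y (lie_bracket X Z)) p h"
  proof (cases "h \<in> Cinf M")
    case True
    have "V p (deriv_along (lie_bracket W U) h) =
        V p (deriv_along W (deriv_along U h)) - V p (deriv_along U (deriv_along W h))"
      if "V \<in> vfields M" "U \<in> vfields M" "W \<in> vfields M" for U V W
      unfolding d using that True by (intro vfield_diff[OF M] vfield_Cinf)
    note 1 = this
    show ?thesis
      by (simp add: lie_bracket_apply 1 X Y Z)
  next
    case False
    then show ?thesis
      using X Y Z by (simp add: vfield_nonsmooth vfields_lie_bracket[OF M])
  qed
qed

lemma one_form_diff:
  assumes "\<omega> \<in> one_forms M" "v \<in> vfields M" "w \<in> vfields M"
  shows "\<omega> (v - w) = \<omega> v - \<omega> w"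
  using one_form_lin[OF M assms Cinf_const[OF M, of 1] Cinf_const[OF M, of "- 1"]] by simp

lemma Cinf_fscale_lin:
  "f \<in> Cinf M \<Longrightarrow> g \<in> Cinf M \<Longrightarrow> a \<in> Cinf M \<Longrightarrow> b \<in> Cinf M \<Longrightarrow> fscale f a + fscale g b \<in> Cinf M"
  using Cinf_add[OF M Cinf_mult[OF M, of f a] Cinf_mult[OF M, of g b]]
  by (simp add: fscale_def plus_fun_def)

lemma one_forms_lin:
  assumes \<beta>: "\<beta> \<in> one_forms M" "\<gamma> \<in> one_forms M" and f: "f \<in> Cinf M" "g \<in> Cinf M"
  shows "(\<lambda>v. fscale f (\<beta> v) + fscale g (\<gamma> v)) \<in> one_forms M"
proof -
  have "fscale f (\<beta> v) + fscale g (\<gamma> v) \<in> Cinf M" if "v \<in> vfields M" for v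
    by (rule Cinf_fscale_lin[OF f one_form_Cinf[OF M \<beta>(1) that] one_form_Cinf[OF M \<beta>(2) that]])
  moreover have "fscale f (\<beta> (fscale a v + fscale b w)) + fscale g (\<gamma> (fscale a v + fscale b w)) =
      fscale a (fscale f (\<beta> v) + fscale g (\<gamma> v)) + fscale b (fscale f (\<beta> w) + fscale g (\<gamma> w))"
    if "v \<in> vfields M" "w \<in> vfields M" "a \<in> Cinf M" "b \<in> Cinf M" for a b v w
    unfolding one_form_lin[OF M \<beta>(1) that] one_form_lin[OF M \<beta>(2) that]
    by (simp add: fscale_def fun_eq_iff algebra_simps)
  moreover have "fscale f (\<beta> v) + fscale g (\<gamma> v) = 0" if "v \<notin> vfields M" for v
    using \<beta> that by (simp add: one_forms_def fscale_def fun_eq_iff)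
  ultimately show ?thesis by (simp add: one_forms_def vforms_def)
qed

section \<open>The anchor of a Lie algebroid\<close>

text \<open>
  Comparing \<open>f u\<close> with \<open>u\<close> in the Jacobi identity for \<open>s, s', f u\<close> leaves
  \<open>(\<rho>[s,s'] - [\<rho> s, \<rho> s'])(f) u = 0\<close>, which determines the anchor at points where some section is
  nonzero. Where all sections vanish, both sides are zero.
\<close>

lemma anchor_bracket:
  assumes A: "lie_algebroid M A \<rho> br" and s: "s \<in> Sec A" "s' \<in> Sec A"
  shows "app \<rho> (br s s') = lie_bracket (app \<rho> s) (app \<rho> s')"
proof (intro ext)
  fix p f
  let ?X = "app \<rho> s" and ?Y = "app \<rho> s'" and ?c = "br s s'"
  have an: "anchored_bundle M A \<rho>"
    and cl: "\<And>s s'. s \<in> Sec A \<Longrightarrow> s' \<in> Sec A \<Longrightarrow> br s s' \<in> Sec A"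
    and lin: "\<And>s s' u a b. s \<in> Sec A \<Longrightarrow> s' \<in> Sec A \<Longrightarrow> u \<in> Sec A \<Longrightarrow>
        br (a *\<^sub>R s + b *\<^sub>R s') u = a *\<^sub>R br s u + b *\<^sub>R br s' u"
    and anti: "\<And>s s'. s \<in> Sec A \<Longrightarrow> s' \<in> Sec A \<Longrightarrow> br s s' = - br s' s"
    and jac: "\<And>s s' u. s \<in> Sec A \<Longrightarrow> s' \<in> Sec A \<Longrightarrow> u \<in> Sec A \<Longrightarrow>
        br s (br s' u) + br s' (br u s) + br u (br s s') = 0"
    and leib: "\<And>s s' f. s \<in> Sec A \<Longrightarrow> s' \<in> Sec A \<Longrightarrow> f \<in> Cinf M \<Longrightarrow>
        br s (fscale f s') = fscale f (br s s') + fscale (deriv_along (app \<rho> s) f) s'"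
    using A unfolding lie_algebroid_def by blast+
  have iv: "ivector_bundle M A" using an by (simp add: anchored_bundle_def)
  have c: "?c \<in> Sec A" using cl s by blast
  have XY: "?X \<in> vfields M" "?Y \<in> vfields M" "app \<rho> ?c \<in> vfields M"
    using vfields_anchor[OF M an] s c by auto
  \<comment> \<open>The axioms give linearity in the first slot; antisymmetry moves it to the
    second.\<close>
  have add: "br u (v + w) = br u v + br u w" if "u \<in> Sec A" "v \<in> Sec A" "w \<in> Sec A" for u v w
    using anti[OF that(1) Sec_add[OF iv that(2,3)]] anti[of u v] anti[of u w] that
      lin[of v w u 1 1] by simp
  have neg: "br u (- v) = - br u v" if "u \<in> Sec A" "v \<in> Sec A" for u v
    using anti[of u "- v"] anti[of u v] that lin[of v v u "- 1" 0]
      Sec_lin[OF M iv that(2,2) Cinf_const[OF M, of "-1"] Cinf_const[OF M, of 0]] by simp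
  have jac': "br s (br s' u) - br s' (br s u) = br ?c u" if u: "u \<in> Sec A" for u
    using jac[OF s u] anti[OF u s(1)] anti[OF u c] neg[OF s(2) cl[OF s(1) u]]
    by (simp add: algebra_simps)
  show "app \<rho> ?c p f = lie_bracket ?X ?Y p f"
  proof (cases "f \<in> Cinf M")
    case False
    then show ?thesis
      using vfield_nonsmooth[OF XY(3)] vfield_nonsmooth[OF vfields_lie_bracket[OF M XY(1,2)]] by simp
  next
    case f: True
    note df = vfield_Cinf[OF XY(1) f] vfield_Cinf[OF XY(2) f]
    show ?thesis
    proof (cases "\<exists>u\<in>Sec A. u p \<noteq> 0")
      case True
      then obtain u where u: "u \<in> Sec A" "u p \<noteq> 0" by blast
      \<comment> \<open>The terms with a single derivative of \<open>f\<close> are together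
        symmetric in \<open>w\<close> and \<open>w'\<close>. The difference of the two orders
        therefore keeps only \<open>f\<close> times the commutator on \<open>u\<close> and the
        commutator of the second derivatives of \<open>f\<close> times \<open>u\<close>.\<close>
      have twice: "br w (br w' (fscale f u)) =
          fscale f (br w (br w' u)) + fscale (deriv_along (app \<rho> w) f) (br w' u) +
          (fscale (deriv_along (app \<rho> w') f) (br w u) +
           fscale (deriv_along (app \<rho> w) (deriv_along (app \<rho> w') f)) u)"
        if w: "w \<in> Sec A" "w' \<in> Sec A" for w w'
      proof -
        have d: "deriv_along (app \<rho> w') f \<in> Cinf M"
          using vfield_Cinf[OF vfields_anchor[OF M an w(2)] f] .
        show ?thesis
          unfolding leib[OF w(2) u(1) f]
            add[OF w(1) Sec_fscale[OF iv cl[OF w(2) u(1)] f] Sec_fscale[OF iv u(1) d]]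
            leib[OF w(1) cl[OF w(2) u(1)] f] leib[OF w(1) u(1) d] ..
      qed
      have 1: "(br s (br s' (fscale f u)) - br s' (br s (fscale f u))) p = br ?c (fscale f u) p"
        using jac'[OF Sec_fscale[OF iv u(1) f]] by simp
      have 2: "br ?c u p = br s (br s' u) p - br s' (br s u) p"
        using fun_cong[OF jac'[OF u(1)], of p] by simp
      have "(app \<rho> ?c p f - lie_bracket ?X ?Y p f) *\<^sub>R u p = 0"
        using 1 unfolding twice[OF s] twice[OF s(2,1)] leib[OF c u(1) f]
        by (simp add: 2 fscale_def lie_bracket_def deriv_along_def algebra_simps)
      then show ?thesis using u(2) by simp
    next
      case False
      have z: "app \<rho> w p = 0" if "w \<in> Sec A" for w
      proof -
        \<comment> \<open>Both coefficients zero: linearity of the anchor gives that \<rho> at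
          \<open>p\<close> sends 0 to 0, and here 0 is the value of \<open>w\<close> at
          \<open>p\<close>.\<close>
        have "app \<rho> (fscale (\<lambda>x. 0) w + fscale (\<lambda>x. 0) w) p = 0"
          unfolding app_anchor_lin[OF M an that that] by simp
        moreover have "w p = 0" using False that by blast
        ultimately show ?thesis by (simp add: app_def)
      qed
      show ?thesis using z[OF s(1)] z[OF s(2)] z[OF c] by (simp add: lie_bracket_def)
    qed
  qed
qed

section \<open>The induced connections on \<open>TM\<close> and \<open>T^*M\<close>\<close>

text \<open>For a multiple of \<open>s\<close> by \<open>f\<close>, the bracket contributes minus
  v(f) \<rho>(s) and the Leibniz rule of the connection contributes plus v(f) \<rho>(s). The two
  cancel.\<close>

lemma Econn_TM_section_lin:
  assumes E: "anchored_bundle M E \<rho>" and nab: "connection M E nab"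
    and s: "s \<in> Sec E" "s' \<in> Sec E" and v: "v \<in> vfields M" and f: "f \<in> Cinf M" "g \<in> Cinf M"
  shows "Econn_TM \<rho> nab (fscale f s + fscale g s') v =
    fscale f (Econn_TM \<rho> nab s v) + fscale g (Econn_TM \<rho> nab s' v)"
proof -
  let ?X = "app \<rho> s" and ?Y = "app \<rho> s'"
  have iv: "ivector_bundle M E" using E by (simp add: anchored_bundle_def)
  have XY: "?X \<in> vfields M" "?Y \<in> vfields M" using vfields_anchor[OF M E] s by auto
  have n: "nab s v \<in> Sec E" "nab s' v \<in> Sec E"
    using nab s v by (auto simp: connection_def vforms_def)
  have d: "deriv_along v f \<in> Cinf M" "deriv_along v g \<in> Cinf M"
    using vfield_Cinf v f by auto
  have "nab (fscale f s + fscale g s') v = nab (fscale f s) v + nab (fscale g s') v"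
    "nab (fscale f s) v = fscale (deriv_along v f) s + fscale f (nab s v)"
    "nab (fscale g s') v = fscale (deriv_along v g) s' + fscale g (nab s' v)"
    using nab s v f Sec_fscale[OF iv] unfolding connection_def by blast+
  then have 1: "app \<rho> (nab (fscale f s + fscale g s') v) =
      (fscale (deriv_along v f) ?X + fscale f (app \<rho> (nab s v))) +
      (fscale (deriv_along v g) ?Y + fscale g (app \<rho> (nab s' v)))"
    using app_anchor_add[OF E Sec_lin[OF M iv s(1) n(1) d(1) f(1)] Sec_lin[OF M iv s(2) n(2) d(2) f(2)]]
      app_anchor_lin[OF M E s(1) n(1)] app_anchor_lin[OF M E s(2) n(2)] by simp
  have 2: "lie_bracket (fscale f ?X + fscale g ?Y) v =
      fscale f (lie_bracket ?X v) + fscale g (lie_bracket ?Y v) -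
      (fscale (deriv_along v f) ?X + fscale (deriv_along v g) ?Y)"
    unfolding lie_bracket_swap[of _ v] lie_bracket_lin[OF M v XY f]
    by (simp add: fscale_def fun_eq_iff scaleR_fun_def)
  show ?thesis
    unfolding Econn_TM_def app_anchor_lin[OF M E s] 1 2
    by (simp add: fscale_def fun_eq_iff algebra_simps scaleR_fun_def)
qed

lemma Econn_T'M_section_lin:
  assumes E: "anchored_bundle M E \<rho>" and nab: "connection M E nab"
    and s: "s \<in> Sec E" "s' \<in> Sec E" and \<omega>: "\<omega> \<in> one_forms M" and f: "f \<in> Cinf M" "g \<in> Cinf M"
  shows "Econn_T'M M \<rho> nab (fscale f s + fscale g s') \<omega> =
    (\<lambda>v. fscale f (Econn_T'M M \<rho> nab s \<omega> v) + fscale g (Econn_T'M M \<rho> nab s' \<omega> v))"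
proof
  fix v
  show "Econn_T'M M \<rho> nab (fscale f s + fscale g s') \<omega> v =
    fscale f (Econn_T'M M \<rho> nab s \<omega> v) + fscale g (Econn_T'M M \<rho> nab s' \<omega> v)"
  proof (cases "v \<in> vfields M")
    case v: True
    show ?thesis
      using v
      unfolding Econn_T'M_def Econn_TM_section_lin[OF E nab s v f] app_anchor_lin[OF M E s]
        one_form_lin[OF M \<omega> vfields_Econn_TM[OF M E nab s(1) v] vfields_Econn_TM[OF M E nab s(2) v] f]
      by (simp add: fscale_def fun_eq_iff deriv_along_def algebra_simps scaleR_fun_def)
  qed (simp add: Econn_T'M_def fscale_def fun_eq_iff)
qed

text \<open>Derivatives of the coefficients arise only where \<rho>(s) differentiates the value of
  the form; the other term merely evaluates the form at a different vector field.\<close>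

lemma Econn_T'M_lin:
  assumes E: "anchored_bundle M E \<rho>" and nab: "connection M E nab" and s: "s \<in> Sec E"
    and \<beta>: "\<beta> \<in> one_forms M" "\<gamma> \<in> one_forms M" and f: "f \<in> Cinf M" "g \<in> Cinf M"
  shows "Econn_T'M M \<rho> nab s (\<lambda>v. fscale f (\<beta> v) + fscale g (\<gamma> v)) =
    (\<lambda>v. (fscale f (Econn_T'M M \<rho> nab s \<beta> v) + fscale g (Econn_T'M M \<rho> nab s \<gamma> v)) +
      (fscale (deriv_along (app \<rho> s) f) (\<beta> v) + fscale (deriv_along (app \<rho> s) g) (\<gamma> v)))"
proof
  fix v
  let ?X = "app \<rho> s"
  have X: "?X \<in> vfields M" using vfields_anchor[OF M E s] .
  show "Econn_T'M M \<rho> nab s (\<lambda>v. fscale f (\<beta> v) + fscale g (\<gamma> v)) v =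
      (fscale f (Econn_T'M M \<rho> nab s \<beta> v) + fscale g (Econn_T'M M \<rho> nab s \<gamma> v)) +
      (fscale (deriv_along ?X f) (\<beta> v) + fscale (deriv_along ?X g) (\<gamma> v))"
  proof (cases "v \<in> vfields M")
    case v: True
    have c: "\<beta> v \<in> Cinf M" "\<gamma> v \<in> Cinf M" using one_form_Cinf[OF M _ v] \<beta> by auto
    show ?thesis
      using v unfolding Econn_T'M_def deriv_along_lin[OF X f c]
      by (simp add: fscale_def fun_eq_iff algebra_simps)
  next
    case False
    then have "\<beta> v = 0" "\<gamma> v = 0" using \<beta> by (auto simp: one_forms_def)
    then show ?thesis using False by (simp add: Econn_T'M_def fscale_def fun_eq_iff)
  qed
qed

text \<open>After the anchor is applied, the six terms of the Cartan identity match the terms of the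
  commutator that contain \<open>nab\<close>. The remaining double brackets are those of the Jacobi
  identity for the two anchored fields and \<open>v\<close>.\<close>

lemma Econn_TM_flat:
  assumes A: "lie_algebroid M A \<rho> br" and nab: "cartan_connection M A \<rho> br nab"
    and s: "s \<in> Sec A" "s' \<in> Sec A" and v: "v \<in> vfields M"
  shows "Econn_TM \<rho> nab (br s s') v =
    Econn_TM \<rho> nab s (Econn_TM \<rho> nab s' v) - Econn_TM \<rho> nab s' (Econn_TM \<rho> nab s v)"
proof -
  let ?X = "app \<rho> s" and ?Y = "app \<rho> s'"
  have an: "anchored_bundle M A \<rho>" and cl: "\<And>s s'. s \<in> Sec A \<Longrightarrow> s' \<in> Sec A \<Longrightarrow> br s s' \<in> Sec A"
    using A unfolding lie_algebroid_def by blast+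
  have iv: "ivector_bundle M A" using an by (simp add: anchored_bundle_def)
  have XY: "?X \<in> vfields M" "?Y \<in> vfields M" using vfields_anchor[OF M an] s by auto
  have con: "connection M A nab" and cartan: "nab (br s s') v =
      lie_deriv_vform \<rho> br s (nab s') v - lie_deriv_vform \<rho> br s' (nab s) v
      - nab s' (app \<rho> (nab s v)) + nab s (app \<rho> (nab s' v))"
    using nab s v unfolding cartan_connection_def by blast+
  have nS: "nab u w \<in> Sec A" if "u \<in> Sec A" "w \<in> vfields M" for u w
    using con that by (auto simp: connection_def vforms_def)
  have nadd: "nab u (w + w') = nab u w + nab u w'"
    if "u \<in> Sec A" "w \<in> vfields M" "w' \<in> vfields M" for u w w'
  proof -
    have "nab u (fscale (\<lambda>x. 1) w + fscale (\<lambda>x. 1) w') =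
        fscale (\<lambda>x. 1) (nab u w) + fscale (\<lambda>x. 1) (nab u w')"
      using con that Cinf_const[OF M, of 1] unfolding connection_def vforms_def by blast
    then show ?thesis by simp
  qed
  note va = vfields_anchor[OF M an] and lb = vfields_lie_bracket[OF M]
  note n = nS[OF s(1) v] nS[OF s(2) v]
  have E2: "Econn_TM \<rho> nab u (Econn_TM \<rho> nab u' v) =
      lie_bracket (app \<rho> u) (lie_bracket (app \<rho> u') v) + lie_bracket (app \<rho> u) (app \<rho> (nab u' v)) +
      (app \<rho> (nab u (lie_bracket (app \<rho> u') v)) + app \<rho> (nab u (app \<rho> (nab u' v))))"
    if u: "u \<in> Sec A" "u' \<in> Sec A" for u u'
  proof -
    have w: "lie_bracket (app \<rho> u') v \<in> vfields M" "app \<rho> (nab u' v) \<in> vfields M"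
      using lb[OF va[OF u(2)] v] va[OF nS[OF u(2) v]] by auto
    show ?thesis
      unfolding Econn_TM_def nadd[OF u(1) w] lie_bracket_add[OF va[OF u(1)] w]
        app_anchor_add[OF an nS[OF u(1) w(1)] nS[OF u(1) w(2)]] ..
  qed
  have S: "br s (nab s' v) \<in> Sec A" "nab s' (lie_bracket ?X v) \<in> Sec A"
    "br s' (nab s v) \<in> Sec A" "nab s (lie_bracket ?Y v) \<in> Sec A"
    "nab s' (app \<rho> (nab s v)) \<in> Sec A" "nab s (app \<rho> (nab s' v)) \<in> Sec A"
    using cl nS s n va lb v by blast+
  have R: "app \<rho> (nab (br s s') v) =
      lie_bracket ?X (app \<rho> (nab s' v)) - app \<rho> (nab s' (lie_bracket ?X v))
      - (lie_bracket ?Y (app \<rho> (nab s v)) - app \<rho> (nab s (lie_bracket ?Y v)))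
      - app \<rho> (nab s' (app \<rho> (nab s v))) + app \<rho> (nab s (app \<rho> (nab s' v)))"
    unfolding cartan lie_deriv_vform_def
    using S by (simp add: app_anchor_add[OF an] app_anchor_diff[OF an] Sec_diff[OF iv]
        anchor_bracket[OF A] s n)
  show ?thesis
    unfolding E2[OF s] E2[OF s(2,1)] Econn_TM_def[of _ _ "br s s'"] R anchor_bracket[OF A s]
      lie_bracket_Jacobi[OF XY v]
    by (simp add: algebra_simps)
qed

text \<open>In the twofold derivative evaluated at \<open>v\<close>, the two terms with one
  derivative along the anchor are symmetric in the sections and cancel in the commutator. The last
  term applies the operators on \<open>TM\<close> in reversed order, which accounts for the sign in
  the dual connection.\<close>

lemma Econn_T'M_flat:
  assumes A: "lie_algebroid M A \<rho> br" and nab: "cartan_connection M A \<rho> br nab"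
    and s: "s \<in> Sec A" "s' \<in> Sec A" and \<omega>: "\<omega> \<in> one_forms M"
  shows "Econn_T'M M \<rho> nab (br s s') \<omega> =
    Econn_T'M M \<rho> nab s (Econn_T'M M \<rho> nab s' \<omega>) - Econn_T'M M \<rho> nab s' (Econn_T'M M \<rho> nab s \<omega>)"
proof
  fix v
  let ?D = "Econn_T'M M \<rho> nab"
  have an: "anchored_bundle M A \<rho>" using A unfolding lie_algebroid_def by blast
  have con: "connection M A nab" using nab unfolding cartan_connection_def by blast
  show "?D (br s s') \<omega> v = (?D s (?D s' \<omega>) - ?D s' (?D s \<omega>)) v"
  proof (cases "v \<in> vfields M")
    case v: True
    have EE: "Econn_TM \<rho> nab u (Econn_TM \<rho> nab u' v) \<in> vfields M" "Econn_TM \<rho> nab u v \<in> vfields M"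
      if "u \<in> Sec A" "u' \<in> Sec A" for u u'
      using vfields_Econn_TM[OF M an con] that v by blast+
    have D2: "?D u (?D u' \<omega>) v p = app \<rho> u p (deriv_along (app \<rho> u') (\<omega> v))
        - app \<rho> u p (\<omega> (Econn_TM \<rho> nab u' v)) - app \<rho> u' p (\<omega> (Econn_TM \<rho> nab u v))
        + \<omega> (Econn_TM \<rho> nab u' (Econn_TM \<rho> nab u v)) p"
      if u: "u \<in> Sec A" "u' \<in> Sec A" for u u' p
    proof -
      have "app \<rho> u p (deriv_along (app \<rho> u') (\<omega> v) - \<omega> (Econn_TM \<rho> nab u' v)) =
          app \<rho> u p (deriv_along (app \<rho> u') (\<omega> v)) - app \<rho> u p (\<omega> (Econn_TM \<rho> nab u' v))"
        using vfield_diff[OF M vfields_anchor[OF M an u(1)]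
            vfield_Cinf[OF vfields_anchor[OF M an u(2)] one_form_Cinf[OF M \<omega> v]]
            one_form_Cinf[OF M \<omega> EE(2)[OF u(2,1)]], of p]
        by (simp add: fun_diff_def)
      then show ?thesis
        using v EE[OF u] by (simp add: Econn_T'M_def deriv_along_def)
    qed
    have "?D (br s s') \<omega> v p = ?D s (?D s' \<omega>) v p - ?D s' (?D s \<omega>) v p" for p
      unfolding D2[OF s] D2[OF s(2,1)] using v
      by (simp add: Econn_T'M_def anchor_bracket[OF A s] Econn_TM_flat[OF A nab s v]
          one_form_diff[OF \<omega> EE(1)[OF s] EE(1)[OF s(2,1)]] lie_bracket_def deriv_along_def)
    then show ?thesis by (simp add: fun_eq_iff)
  qed (simp add: Econn_T'M_def)
qed

end


section \<open>The induced connection on tensor fields\<close>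

text \<open>
  The action of the \<open>i\<close>-th connection on the \<open>i\<close>-th argument is split into a map on the forms and a
  map on the vector fields; the variance of the factor makes one of them the identity.
\<close>

definition form_update ::
    "'m mfd \<Rightarrow> ('m \<Rightarrow> 'v \<Rightarrow> 'm tvec) \<Rightarrow> variance list \<Rightarrow> (nat \<Rightarrow> ('m, 'v) conn) \<Rightarrow>
     ('m \<Rightarrow> 'v) \<Rightarrow> nat \<Rightarrow> (nat \<Rightarrow> 'm form) \<Rightarrow> nat \<Rightarrow> 'm form" where
  "form_update M \<rho> \<kappa> nab s i \<alpha> =
     (case \<kappa> ! i of Contra \<Rightarrow> \<alpha>(i := Econn_T'M M \<rho> (nab i) s (\<alpha> i)) | Co \<Rightarrow> \<alpha>)"

definition vec_update ::
    "('m \<Rightarrow> 'v \<Rightarrow> 'm tvec) \<Rightarrow> variance list \<Rightarrow> (nat \<Rightarrow> ('m, 'v) conn) \<Rightarrow>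
     ('m \<Rightarrow> 'v) \<Rightarrow> nat \<Rightarrow> (nat \<Rightarrow> 'm \<Rightarrow> 'm tvec) \<Rightarrow> nat \<Rightarrow> 'm \<Rightarrow> 'm tvec" where
  "vec_update \<rho> \<kappa> nab s i X =
     (case \<kappa> ! i of Contra \<Rightarrow> X | Co \<Rightarrow> X(i := Econn_TM \<rho> (nab i) s (X i)))"

text \<open>Both variances now give summands of one shape, so sums and commutators of operators can
  be handled without a case distinction.\<close>

lemma Econn_comb_args:
  "tensor_args M \<kappa> \<alpha> X \<Longrightarrow> Econn_comb M \<rho> \<kappa> nab s t \<alpha> X = deriv_along (app \<rho> s) (t \<alpha> X) -
     (\<Sum>i<length \<kappa>. t (form_update M \<rho> \<kappa> nab s i \<alpha>) (vec_update \<rho> \<kappa> nab s i X))"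
  by (auto simp: Econn_comb_def form_update_def vec_update_def intro!: sum.cong split: variance.split)

lemma Econn_comb_nonargs:
  "\<not> tensor_args M \<kappa> \<alpha> X \<Longrightarrow> Econn_comb M \<rho> \<kappa> nab s t \<alpha> X = 0"
  by (simp add: Econn_comb_def)

lemma form_update_commute:
  "i \<noteq> j \<Longrightarrow> form_update M \<rho> \<kappa> nab s i (form_update M \<rho> \<kappa> nab s' j \<alpha>) =
     form_update M \<rho> \<kappa> nab s' j (form_update M \<rho> \<kappa> nab s i \<alpha>)"
  by (auto simp: form_update_def split: variance.split)

lemma vec_update_commute:
  "i \<noteq> j \<Longrightarrow> vec_update \<rho> \<kappa> nab s i (vec_update \<rho> \<kappa> nab s' j X) =
     vec_update \<rho> \<kappa> nab s' j (vec_update \<rho> \<kappa> nab s i X)"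
  by (auto simp: vec_update_def split: variance.split)

lemma tensor_fields_Cinf: "t \<in> tensor_fields M \<kappa> \<Longrightarrow> tensor_args M \<kappa> \<alpha> X \<Longrightarrow> t \<alpha> X \<in> Cinf M"
  and tensor_fields_nonargs: "t \<in> tensor_fields M \<kappa> \<Longrightarrow> \<not> tensor_args M \<kappa> \<alpha> X \<Longrightarrow> t \<alpha> X = 0"
  and tensor_fields_cong: "t \<in> tensor_fields M \<kappa> \<Longrightarrow>
    (\<And>i. i < length \<kappa> \<Longrightarrow> case \<kappa> ! i of Contra \<Rightarrow> \<alpha> i = \<alpha>' i | Co \<Rightarrow> X i = X' i) \<Longrightarrow> t \<alpha> X = t \<alpha>' X'"
  unfolding tensor_fields_def by blast+

lemma tensor_form_lin:
  assumes "t \<in> tensor_fields M \<kappa>" "tensor_args M \<kappa> \<alpha> X" "i < length \<kappa>" "\<kappa> ! i = Contra"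
    "\<beta> \<in> one_forms M" "\<gamma> \<in> one_forms M" "f \<in> Cinf M" "g \<in> Cinf M"
  shows "t (\<alpha>(i := (\<lambda>v. fscale f (\<beta> v) + fscale g (\<gamma> v)))) X =
    fscale f (t (\<alpha>(i := \<beta>)) X) + fscale g (t (\<alpha>(i := \<gamma>)) X)"
proof -
  have "case \<kappa> ! i of
      Contra \<Rightarrow> (\<forall>\<beta>\<in>one_forms M. \<forall>\<gamma>\<in>one_forms M.
        t (\<alpha>(i := (\<lambda>v. fscale f (\<beta> v) + fscale g (\<gamma> v)))) X =
        fscale f (t (\<alpha>(i := \<beta>)) X) + fscale g (t (\<alpha>(i := \<gamma>)) X))
    | Co \<Rightarrow> (\<forall>v\<in>vfields M. \<forall>w\<in>vfields M.
        t \<alpha> (X(i := fscale f v + fscale g w)) =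
        fscale f (t \<alpha> (X(i := v))) + fscale g (t \<alpha> (X(i := w))))"
    using assms(1-3,7,8) unfolding tensor_fields_def by blast
  then show ?thesis using assms(4-6) by simp
qed

lemma tensor_vec_lin:
  assumes "t \<in> tensor_fields M \<kappa>" "tensor_args M \<kappa> \<alpha> X" "i < length \<kappa>" "\<kappa> ! i = Co"
    "v \<in> vfields M" "w \<in> vfields M" "f \<in> Cinf M" "g \<in> Cinf M"
  shows "t \<alpha> (X(i := fscale f v + fscale g w)) =
    fscale f (t \<alpha> (X(i := v))) + fscale g (t \<alpha> (X(i := w)))"
proof -
  have "case \<kappa> ! i of
      Contra \<Rightarrow> (\<forall>\<beta>\<in>one_forms M. \<forall>\<gamma>\<in>one_forms M.
        t (\<alpha>(i := (\<lambda>v. fscale f (\<beta> v) + fscale g (\<gamma> v)))) X =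
        fscale f (t (\<alpha>(i := \<beta>)) X) + fscale g (t (\<alpha>(i := \<gamma>)) X))
    | Co \<Rightarrow> (\<forall>v\<in>vfields M. \<forall>w\<in>vfields M.
        t \<alpha> (X(i := fscale f v + fscale g w)) =
        fscale f (t \<alpha> (X(i := v))) + fscale g (t \<alpha> (X(i := w))))"
    using assms(1-3,7,8) unfolding tensor_fields_def by blast
  then show ?thesis using assms(4-6) by simp
qed

text \<open>The setting for everything that involves no bracket, namely that \<open>D\<close> is a
  connection on tensor fields. The locale \<open>cartan_connections\<close> adds the bracket and the
  Cartan condition, on which flatness rests.\<close>

locale anchored_connections =
  fixes M :: "'m::{t2_space,second_countable_topology} mfd"
    and E :: "('m, 'v::real_vector) ivbundle" and \<rho> :: "'m \<Rightarrow> 'v \<Rightarrow> 'm tvec"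
    and \<kappa> :: "variance list" and nab :: "nat \<Rightarrow> ('m, 'v) conn"
  assumes M: "smooth_manifold M" and anchored: "anchored_bundle M E \<rho>"
    and nab: "\<And>i. i < length \<kappa> \<Longrightarrow> connection M E (nab i)"
begin

abbreviation "D \<equiv> Econn_comb M \<rho> \<kappa> nab"
abbreviation "P \<equiv> form_update M \<rho> \<kappa> nab"
abbreviation "Q \<equiv> vec_update \<rho> \<kappa> nab"

lemma ivector: "ivector_bundle M E"
  using anchored by (simp add: anchored_bundle_def)

lemma anchor_vfield: "s \<in> Sec E \<Longrightarrow> app \<rho> s \<in> vfields M"
  by (rule vfields_anchor[OF M anchored])

lemma args_update:
  assumes s: "s \<in> Sec E" and i: "i < length \<kappa>" and a: "tensor_args M \<kappa> \<alpha> X"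
  shows "tensor_args M \<kappa> (P s i \<alpha>) (Q s i X)"
proof (cases "\<kappa> ! i")
  case Contra
  then have "\<alpha> i \<in> one_forms M" using a i by (auto simp: tensor_args_def split: variance.splits)
  then show ?thesis
    using Contra tensor_args_upd(1)[OF M a one_forms_Econn_T'M[OF M anchored nab[OF i] s]]
    by (simp add: form_update_def vec_update_def)
next
  case Co
  then have "X i \<in> vfields M" using a i by (auto simp: tensor_args_def split: variance.splits)
  then show ?thesis
    using Co tensor_args_upd(2)[OF M a vfields_Econn_TM[OF M anchored nab[OF i] s]]
    by (simp add: form_update_def vec_update_def)
qed

lemma tensor_form_add:
  assumes "t \<in> tensor_fields M \<kappa>" "tensor_args M \<kappa> \<alpha> X" "i < length \<kappa>" "\<kappa> ! i = Contra"
    "\<beta> \<in> one_forms M" "\<gamma> \<in> one_forms M"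
  shows "t (\<alpha>(i := (\<lambda>v. \<beta> v + \<gamma> v))) X = t (\<alpha>(i := \<beta>)) X + t (\<alpha>(i := \<gamma>)) X"
  using tensor_form_lin[OF assms Cinf_const[OF M, of 1] Cinf_const[OF M, of 1]] by simp

lemma tensor_vec_add:
  assumes "t \<in> tensor_fields M \<kappa>" "tensor_args M \<kappa> \<alpha> X" "i < length \<kappa>" "\<kappa> ! i = Co"
    "v \<in> vfields M" "w \<in> vfields M"
  shows "t \<alpha> (X(i := v + w)) = t \<alpha> (X(i := v)) + t \<alpha> (X(i := w))"
  using tensor_vec_lin[OF assms Cinf_const[OF M, of 1] Cinf_const[OF M, of 1]] by simp

section \<open>Function-linearity in the section\<close>

lemma update_section_lin:
  assumes t: "t \<in> tensor_fields M \<kappa>" and a: "tensor_args M \<kappa> \<alpha> X" and i: "i < length \<kappa>"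
    and s: "s \<in> Sec E" "s' \<in> Sec E" and f: "f \<in> Cinf M" "g \<in> Cinf M"
  shows "t (P (fscale f s + fscale g s') i \<alpha>) (Q (fscale f s + fscale g s') i X) =
    fscale f (t (P s i \<alpha>) (Q s i X)) + fscale g (t (P s' i \<alpha>) (Q s' i X))"
proof (cases "\<kappa> ! i")
  case Contra
  then have \<alpha>: "\<alpha> i \<in> one_forms M" using a i by (auto simp: tensor_args_def split: variance.splits)
  note E' = one_forms_Econn_T'M[OF M anchored nab[OF i] _ \<alpha>]
  show ?thesis
    using Contra
    by (simp add: form_update_def vec_update_def Econn_T'M_section_lin[OF M anchored nab[OF i] s \<alpha> f]
        tensor_form_lin[OF t a i Contra E'[OF s(1)] E'[OF s(2)] f])
next
  case Co
  then have X: "X i \<in> vfields M" using a i by (auto simp: tensor_args_def split: variance.splits)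
  note E' = vfields_Econn_TM[OF M anchored nab[OF i] _ X]
  show ?thesis
    using Co
    by (simp add: form_update_def vec_update_def Econn_TM_section_lin[OF M anchored nab[OF i] s X f]
        tensor_vec_lin[OF t a i Co E'[OF s(1)] E'[OF s(2)] f])
qed

lemma Econn_comb_section_lin:
  assumes t: "t \<in> tensor_fields M \<kappa>"
    and s: "s \<in> Sec E" "s' \<in> Sec E" and f: "f \<in> Cinf M" "g \<in> Cinf M"
  shows "D (fscale f s + fscale g s') t = tensor_scale f (D s t) + tensor_scale g (D s' t)"
proof (intro ext)
  fix \<alpha> X p
  show "D (fscale f s + fscale g s') t \<alpha> X p =
      (tensor_scale f (D s t) + tensor_scale g (D s' t)) \<alpha> X p"
  proof (cases "tensor_args M \<kappa> \<alpha> X")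
    case True
    then show ?thesis
      by (simp add: tensor_scale_def Econn_comb_args update_section_lin[OF t True _ s f]
          app_anchor_lin[OF M anchored s] sum.distrib fscale_sum[symmetric] fscale_diff)
        (simp add: fscale_def deriv_along_def scaleR_fun_def algebra_simps)
  qed (simp add: tensor_scale_def Econn_comb_nonargs fscale_def)
qed

text \<open>
  The derivatives of \<open>f\<close> and \<open>g\<close> coming from the \<open>k\<close>-th argument cancel those coming from the value
  of the tensor field, so that \<open>D s t\<close> is again function-multilinear.
\<close>

lemma Leibniz_cancel:
  fixes k n :: nat
  assumes X: "X \<in> vfields M" and f: "f \<in> Cinf M" "g \<in> Cinf M" and a: "a \<in> Cinf M" "b \<in> Cinf M"
    and k: "k < n"
    and T: "\<And>i. i < n \<Longrightarrow> T i = fscale f (Ta i) + fscale g (Tb i) +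
      (if i = k then fscale (deriv_along X f) a + fscale (deriv_along X g) b else 0)"
  shows "deriv_along X (fscale f a + fscale g b) - (\<Sum>i<n. T i) =
    fscale f (deriv_along X a - (\<Sum>i<n. Ta i)) + fscale g (deriv_along X b - (\<Sum>i<n. Tb i))"
proof -
  have "(\<Sum>i<n. T i) = (\<Sum>i<n. fscale f (Ta i) + fscale g (Tb i) +
      (if i = k then fscale (deriv_along X f) a + fscale (deriv_along X g) b else 0))"
    by (rule sum.cong[OF refl]) (simp only: T lessThan_iff)
  also have "\<dots> = fscale f (\<Sum>i<n. Ta i) + fscale g (\<Sum>i<n. Tb i) +
      (fscale (deriv_along X f) a + fscale (deriv_along X g) b)"
    using k by (simp add: sum.distrib fscale_sum)
  finally show ?thesis
    unfolding deriv_along_lin[OF M X f a] by (simp add: fscale_diff)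
qed

text \<open>An update at another position commutes with inserting the form at \<open>k\<close>, so
  multilinearity of \<open>t\<close> suffices. The update at \<open>k\<close> itself produces the
  derivatives of \<open>f\<close> and \<open>g\<close> that \<open>Leibniz_cancel\<close>
  removes.\<close>

lemma Econn_comb_form_lin:
  assumes t: "t \<in> tensor_fields M \<kappa>" and s: "s \<in> Sec E"
    and a: "tensor_args M \<kappa> \<alpha> X" and k: "k < length \<kappa>" "\<kappa> ! k = Contra"
    and \<beta>: "\<beta> \<in> one_forms M" "\<gamma> \<in> one_forms M" and f: "f \<in> Cinf M" "g \<in> Cinf M"
  shows "D s t (\<alpha>(k := (\<lambda>v. fscale f (\<beta> v) + fscale g (\<gamma> v)))) X =
    fscale f (D s t (\<alpha>(k := \<beta>)) X) + fscale g (D s t (\<alpha>(k := \<gamma>)) X)"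
proof -
  let ?c = "\<lambda>v. fscale f (\<beta> v) + fscale g (\<gamma> v)" and ?Z = "app \<rho> s"
  note Z = anchor_vfield[OF s] and upd = tensor_args_upd(1)[OF M a]
  have dZ: "deriv_along ?Z f \<in> Cinf M" "deriv_along ?Z g \<in> Cinf M"
    using vfield_Cinf[OF M Z] f by auto
  have c: "?c \<in> one_forms M" by (rule one_forms_lin[OF M \<beta> f])
  have T: "t (P s i (\<alpha>(k := ?c))) (Q s i X) =
      fscale f (t (P s i (\<alpha>(k := \<beta>))) (Q s i X)) + fscale g (t (P s i (\<alpha>(k := \<gamma>))) (Q s i X)) +
      (if i = k then fscale (deriv_along ?Z f) (t (\<alpha>(k := \<beta>)) X) +
        fscale (deriv_along ?Z g) (t (\<alpha>(k := \<gamma>)) X) else 0)"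
    if i: "i < length \<kappa>" for i
  proof (cases "i = k")
    case True
    note E' = one_forms_Econn_T'M[OF M anchored nab[OF k(1)] s]
    show ?thesis
      using True k
      by (simp add: form_update_def vec_update_def Econn_T'M_lin[OF M anchored nab[OF k(1)] s \<beta> f]
          tensor_form_add[OF t a k one_forms_lin[OF M E'[OF \<beta>(1)] E'[OF \<beta>(2)] f]
            one_forms_lin[OF M \<beta> dZ]]
          tensor_form_lin[OF t a k E'[OF \<beta>(1)] E'[OF \<beta>(2)] f] tensor_form_lin[OF t a k \<beta> dZ])
  next
    case False
    have P: "P s i (\<alpha>(k := \<delta>)) = (P s i \<alpha>)(k := \<delta>)" for \<delta>
      using False by (auto simp: form_update_def split: variance.split)
    show ?thesis
      unfolding P using False by (simp add: tensor_form_lin[OF t args_update[OF s i a] k \<beta> f])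
  qed
  show ?thesis
    unfolding Econn_comb_args[OF upd[OF c]] Econn_comb_args[OF upd[OF \<beta>(1)]]
      Econn_comb_args[OF upd[OF \<beta>(2)]] tensor_form_lin[OF t a k \<beta> f]
    by (rule Leibniz_cancel[OF Z f tensor_fields_Cinf[OF t upd[OF \<beta>(1)]]
          tensor_fields_Cinf[OF t upd[OF \<beta>(2)]] k(1) T])
qed

lemma Econn_comb_vec_lin:
  assumes t: "t \<in> tensor_fields M \<kappa>" and s: "s \<in> Sec E"
    and a: "tensor_args M \<kappa> \<alpha> X" and k: "k < length \<kappa>" "\<kappa> ! k = Co"
    and v: "v \<in> vfields M" "w \<in> vfields M" and f: "f \<in> Cinf M" "g \<in> Cinf M"
  shows "D s t \<alpha> (X(k := fscale f v + fscale g w)) =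
    fscale f (D s t \<alpha> (X(k := v))) + fscale g (D s t \<alpha> (X(k := w)))"
proof -
  let ?c = "fscale f v + fscale g w" and ?Z = "app \<rho> s"
  note Z = anchor_vfield[OF s] and upd = tensor_args_upd(2)[OF M a]
  note lin = vfields_add[OF M vfields_fscale[OF M] vfields_fscale[OF M]]
  have dZ: "deriv_along ?Z f \<in> Cinf M" "deriv_along ?Z g \<in> Cinf M"
    using vfield_Cinf[OF M Z] f by auto
  have c: "?c \<in> vfields M" by (rule lin[OF f(1) v(1) f(2) v(2)])
  have T: "t (P s i \<alpha>) (Q s i (X(k := ?c))) =
      fscale f (t (P s i \<alpha>) (Q s i (X(k := v)))) + fscale g (t (P s i \<alpha>) (Q s i (X(k := w)))) +
      (if i = k then fscale (deriv_along ?Z f) (t \<alpha> (X(k := v))) +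
        fscale (deriv_along ?Z g) (t \<alpha> (X(k := w))) else 0)"
    if i: "i < length \<kappa>" for i
  proof (cases "i = k")
    case True
    note E' = vfields_Econn_TM[OF M anchored nab[OF k(1)] s]
    show ?thesis
      using True k
      by (simp add: form_update_def vec_update_def Econn_TM_lin[OF M anchored nab[OF k(1)] s v f]
          tensor_vec_add[OF t a k lin[OF f(1) E'[OF v(1)] f(2) E'[OF v(2)]]
            lin[OF dZ(1) v(1) dZ(2) v(2)]]
          tensor_vec_lin[OF t a k E'[OF v(1)] E'[OF v(2)] f] tensor_vec_lin[OF t a k v dZ])
  next
    case False
    have Q: "Q s i (X(k := u)) = (Q s i X)(k := u)" for u
      using False by (auto simp: vec_update_def split: variance.split)
    show ?thesis
      unfolding Q using False by (simp add: tensor_vec_lin[OF t args_update[OF s i a] k v f])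
  qed
  show ?thesis
    unfolding Econn_comb_args[OF upd[OF c]] Econn_comb_args[OF upd[OF v(1)]]
      Econn_comb_args[OF upd[OF v(2)]] tensor_vec_lin[OF t a k v f]
    by (rule Leibniz_cancel[OF Z f tensor_fields_Cinf[OF t upd[OF v(1)]]
          tensor_fields_Cinf[OF t upd[OF v(2)]] k(1) T])
qed

text \<open>An update at position \<open>i\<close> reads only the entry selected by the variance of
  that position, so differences in ignored entries never reach \<open>t\<close>.\<close>

lemma Econn_comb_cong:
  assumes t: "t \<in> tensor_fields M \<kappa>"
    and eq: "\<And>i. i < length \<kappa> \<Longrightarrow> case \<kappa> ! i of Contra \<Rightarrow> \<alpha> i = \<alpha>' i | Co \<Rightarrow> X i = X' i"
  shows "D s t \<alpha> X = D s t \<alpha>' X'"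
proof -
  have args: "tensor_args M \<kappa> \<alpha> X \<longleftrightarrow> tensor_args M \<kappa> \<alpha>' X'"
  proof -
    have "(case \<kappa> ! i of Contra \<Rightarrow> \<alpha> i \<in> one_forms M | Co \<Rightarrow> X i \<in> vfields M) \<longleftrightarrow>
        (case \<kappa> ! i of Contra \<Rightarrow> \<alpha>' i \<in> one_forms M | Co \<Rightarrow> X' i \<in> vfields M)"
      if "i < length \<kappa>" for i
      using eq[OF that] by (cases "\<kappa> ! i") simp_all
    then show ?thesis unfolding tensor_args_def by blast
  qed
  have "t (P s i \<alpha>) (Q s i X) = t (P s i \<alpha>') (Q s i X')" if "i < length \<kappa>" for i
  proof (rule tensor_fields_cong[OF t])
    fix j assume "j < length \<kappa>"
    then show "case \<kappa> ! j of Contra \<Rightarrow> P s i \<alpha> j = P s i \<alpha>' j | Co \<Rightarrow> Q s i X j = Q s i X' j"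
      using eq[of j] eq[OF that]
      by (cases "\<kappa> ! j"; cases "\<kappa> ! i"; cases "i = j") (auto simp: form_update_def vec_update_def)
  qed
  then show ?thesis
    using args tensor_fields_cong[OF t eq]
    by (cases "tensor_args M \<kappa> \<alpha> X") (simp_all add: Econn_comb_args Econn_comb_nonargs)
qed

text \<open>Makes the tensor fields a module on which the operators act, as a representation
  demands.\<close>

lemma Econn_comb_tensor_fields:
  assumes t: "t \<in> tensor_fields M \<kappa>" and s: "s \<in> Sec E"
  shows "D s t \<in> tensor_fields M \<kappa>"
proof -
  note Z = anchor_vfield[OF s]
  have "D s t \<alpha> X \<in> Cinf M" if a: "tensor_args M \<kappa> \<alpha> X" for \<alpha> X
  proof -
    have "(\<Sum>i<length \<kappa>. t (P s i \<alpha>) (Q s i X)) \<in> Cinf M"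
      by (rule vfield_sum[OF M Z finite_lessThan, THEN conjunct1])
        (use tensor_fields_Cinf[OF t args_update[OF s _ a]] in blast)
    then show ?thesis
      using Cinf_diff[OF M vfield_Cinf[OF M Z tensor_fields_Cinf[OF t a]]]
      unfolding Econn_comb_args[OF a] by (simp add: fun_diff_def)
  qed
  then show ?thesis
    unfolding tensor_fields_def mem_Collect_eq
    using Econn_comb_nonargs[of M \<kappa> _ _ \<rho> nab s t] Econn_comb_cong[OF t]
      Econn_comb_form_lin[OF t s] Econn_comb_vec_lin[OF t s]
    by (auto split: variance.split)
qed

lemma Econn_comb_add:
  assumes s: "s \<in> Sec E" and t: "t \<in> tensor_fields M \<kappa>" "t' \<in> tensor_fields M \<kappa>"
  shows "D s (t + t') = D s t + D s t'"
proof (intro ext)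
  fix \<alpha> X p
  show "D s (t + t') \<alpha> X p = (D s t + D s t') \<alpha> X p"
    using deriv_along_add[OF M anchor_vfield[OF s] tensor_fields_Cinf[OF t(1)] tensor_fields_Cinf[OF t(2)]]
    by (cases "tensor_args M \<kappa> \<alpha> X") (simp_all add: Econn_comb_args Econn_comb_nonargs sum.distrib)
qed

text \<open>Only the derivative along \<rho>(s) sees \<open>f\<close>; the update terms carry it
  along as a factor. Off the admissible arguments the extra term vanishes because \<open>t\<close>
  is normalised to zero there.\<close>

lemma Econn_comb_tensor_scale:
  assumes s: "s \<in> Sec E" and f: "f \<in> Cinf M" and t: "t \<in> tensor_fields M \<kappa>"
  shows "D s (tensor_scale f t) =
    tensor_scale (deriv_along (app \<rho> s) f) t + tensor_scale f (D s t)"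
proof (intro ext)
  fix \<alpha> X p
  show "D s (tensor_scale f t) \<alpha> X p =
      (tensor_scale (deriv_along (app \<rho> s) f) t + tensor_scale f (D s t)) \<alpha> X p"
    using deriv_along_fscale[OF M anchor_vfield[OF s] f tensor_fields_Cinf[OF t]]
      tensor_fields_nonargs[OF t]
    by (cases "tensor_args M \<kappa> \<alpha> X")
      (simp_all add: Econn_comb_args Econn_comb_nonargs tensor_scale_def fscale_sum[symmetric]
        fscale_diff)
qed

lemma module_connection_Econn_comb:
  "module_connection M E \<rho> (tensor_fields M \<kappa>) tensor_scale D"
proof -
  have [simp]: "tensor_scale (\<lambda>x. 1) t = t" "tensor_scale (\<lambda>x. 0) t = 0" for t :: "'m tensor"
    by (simp_all add: tensor_scale_def fun_eq_iff)
  have "D (s + s') t = D s t + D s' t"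
    if "s \<in> Sec E" "s' \<in> Sec E" "t \<in> tensor_fields M \<kappa>" for s s' t
    using Econn_comb_section_lin[OF that(3,1,2) Cinf_const[OF M, of 1] Cinf_const[OF M, of 1]] by simp
  moreover have "D (fscale f s) t = tensor_scale f (D s t)"
    if "s \<in> Sec E" "f \<in> Cinf M" "t \<in> tensor_fields M \<kappa>" for s f t
    using Econn_comb_section_lin[OF that(3,1,1,2) Cinf_const[OF M, of 0]] by simp
  ultimately show ?thesis
    unfolding module_connection_def
    using Econn_comb_tensor_fields Econn_comb_add Econn_comb_tensor_scale by blast
qed

end

section \<open>Cartan connections\<close>

locale cartan_connections = anchored_connections M E \<rho> \<kappa> nab
  for M :: "'m::{t2_space,second_countable_topology} mfd"
    and E :: "('m, 'v::real_vector) ivbundle" and \<rho> \<kappa> nab +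
  fixes br :: "('m \<Rightarrow> 'v) \<Rightarrow> ('m \<Rightarrow> 'v) \<Rightarrow> 'm \<Rightarrow> 'v"
  assumes algebroid: "lie_algebroid M E \<rho> br"
    and cartan: "\<And>i. i < length \<kappa> \<Longrightarrow> cartan_connection M E \<rho> br (nab i)"
begin

lemma bracket_Sec: "s \<in> Sec E \<Longrightarrow> s' \<in> Sec E \<Longrightarrow> br s s' \<in> Sec E"
  using algebroid unfolding lie_algebroid_def by blast

text \<open>Flatness on a single tensor factor, carried through \<open>t\<close> by linearity in
  that argument.\<close>

lemma update_bracket:
  assumes t: "t \<in> tensor_fields M \<kappa>" and a: "tensor_args M \<kappa> \<alpha> X" and i: "i < length \<kappa>"
    and s: "s \<in> Sec E" "s' \<in> Sec E"
  shows "t (P (br s s') i \<alpha>) (Q (br s s') i X) =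
    t (P s i (P s' i \<alpha>)) (Q s i (Q s' i X)) - t (P s' i (P s i \<alpha>)) (Q s' i (Q s i X))"
proof (cases "\<kappa> ! i")
  case Contra
  then have \<alpha>: "\<alpha> i \<in> one_forms M" using a i by (auto simp: tensor_args_def split: variance.splits)
  let ?D = "Econn_T'M M \<rho> (nab i)"
  have D2: "?D s (?D s' (\<alpha> i)) \<in> one_forms M" "?D s' (?D s (\<alpha> i)) \<in> one_forms M"
    using one_forms_Econn_T'M[OF M anchored nab[OF i]] s \<alpha> by auto
  \<comment> \<open>The commutator is written with coefficients 1 and -1, the form in which
    linearity of \<open>t\<close> is available.\<close>
  have eq: "?D (br s s') (\<alpha> i) = (\<lambda>v. fscale (\<lambda>x. 1) (?D s (?D s' (\<alpha> i)) v) +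
      fscale (\<lambda>x. - 1) (?D s' (?D s (\<alpha> i)) v))"
    by (simp add: Econn_T'M_flat[OF M algebroid cartan[OF i] s \<alpha>] fun_eq_iff)
  show ?thesis
    using tensor_form_lin[OF t a i Contra D2 Cinf_const[OF M, of 1] Cinf_const[OF M, of "- 1"]] Contra
    unfolding form_update_def vec_update_def eq by simp
next
  case Co
  then have X: "X i \<in> vfields M" using a i by (auto simp: tensor_args_def split: variance.splits)
  let ?D = "Econn_TM \<rho> (nab i)"
  have D2: "?D s (?D s' (X i)) \<in> vfields M" "?D s' (?D s (X i)) \<in> vfields M"
    using vfields_Econn_TM[OF M anchored nab[OF i]] s X by auto
  have eq: "?D (br s s') (X i) = fscale (\<lambda>x. 1) (?D s (?D s' (X i))) +
      fscale (\<lambda>x. - 1) (?D s' (?D s (X i)))"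
    by (simp add: Econn_TM_flat[OF M algebroid cartan[OF i] s X])
  show ?thesis
    using tensor_vec_lin[OF t a i Co D2 Cinf_const[OF M, of 1] Cinf_const[OF M, of "- 1"]] Co
    unfolding form_update_def vec_update_def eq by simp
qed

text \<open>The twofold operator has three kinds of terms. Double derivatives give the anchor of the
  bracket; terms with one derivative and one update are symmetric in the two sections and cancel;
  double updates cancel except at equal positions, where \<open>update_bracket\<close>
  applies.\<close>

lemma Econn_comb_flat:
  assumes t: "t \<in> tensor_fields M \<kappa>" and s: "s \<in> Sec E" "s' \<in> Sec E"
  shows "D (br s s') t = D s (D s' t) - D s' (D s t)"
proof (intro ext)
  fix \<alpha> X p
  show "D (br s s') t \<alpha> X p = (D s (D s' t) - D s' (D s t)) \<alpha> X p"
  proof (cases "tensor_args M \<kappa> \<alpha> X")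
    case a: True
    let ?I = "{..<length \<kappa>}"
    \<comment> \<open>The update by \<open>u\<close> comes first, opposite to the order in
      \<open>D u (D u' t)\<close>, since the outer operator hands updated arguments to the inner
      one. This reversal yields the minus sign on the diagonal.\<close>
    define W where "W u u' i j = t (P u' j (P u i \<alpha>)) (Q u' j (Q u i X)) p" for u u' i j
    have twice: "D u (D u' t) \<alpha> X p = app \<rho> u p (deriv_along (app \<rho> u') (t \<alpha> X))
        - (\<Sum>j\<in>?I. app \<rho> u p (t (P u' j \<alpha>) (Q u' j X)))
        - (\<Sum>i\<in>?I. app \<rho> u' p (t (P u i \<alpha>) (Q u i X))) + (\<Sum>i\<in>?I. \<Sum>j\<in>?I. W u u' i j)"
      if u: "u \<in> Sec E" "u' \<in> Sec E" for u u'
    proof -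
      note Z = anchor_vfield[OF u(1)]
      have S: "(\<Sum>j\<in>?I. t (P u' j \<alpha>) (Q u' j X)) \<in> Cinf M \<and>
          app \<rho> u p (\<Sum>j\<in>?I. t (P u' j \<alpha>) (Q u' j X)) =
          (\<Sum>j\<in>?I. app \<rho> u p (t (P u' j \<alpha>) (Q u' j X)))"
        by (rule vfield_sum[OF M Z finite_lessThan])
          (use tensor_fields_Cinf[OF t args_update[OF u(2) _ a]] in blast)
      have 1: "app \<rho> u p (D u' t \<alpha> X) = app \<rho> u p (deriv_along (app \<rho> u') (t \<alpha> X))
        - (\<Sum>j\<in>?I. app \<rho> u p (t (P u' j \<alpha>) (Q u' j X)))"
        using S vfield_diff[OF M Z vfield_Cinf[OF M anchor_vfield[OF u(2)] tensor_fields_Cinf[OF t a]]]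
        unfolding Econn_comb_args[OF a] by (simp add: fun_diff_def)
      have 2: "D u' t (P u i \<alpha>) (Q u i X) p =
          app \<rho> u' p (t (P u i \<alpha>) (Q u i X)) - (\<Sum>j\<in>?I. W u u' i j)" if "i \<in> ?I" for i
        using that
        by (simp add: Econn_comb_args[OF args_update[OF u(1) _ a]] W_def deriv_along_def sum_fun_apply)
      show ?thesis
        unfolding Econn_comb_args[OF a, of \<rho> nab u "D u' t"]
        by (simp add: 1 2 deriv_along_def[of _ "D u' t \<alpha> X"] sum_fun_apply sum_subtractf)
    qed
    \<comment> \<open>Indices are exchanged in the second term, so that off the diagonal both terms
      make the same two commuting updates. Exchanging the order of summation undoes this
      afterwards.\<close>
    have "W s s' i j - W s' s j i = (if i = j then - t (P (br s s') i \<alpha>) (Q (br s s') i X) p else 0)"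
      if "i \<in> ?I" for i j
      using that update_bracket[OF t a _ s, of i]
        form_update_commute[of i j M \<rho> \<kappa> nab s s'] vec_update_commute[of i j \<rho> \<kappa> nab s s']
      by (auto simp: W_def)
    then have "(\<Sum>i\<in>?I. \<Sum>j\<in>?I. W s s' i j - W s' s j i) =
        - (\<Sum>i\<in>?I. t (P (br s s') i \<alpha>) (Q (br s s') i X) p)"
      by (simp add: sum_negf)
    moreover have "(\<Sum>i\<in>?I. \<Sum>j\<in>?I. W s' s j i) = (\<Sum>i\<in>?I. \<Sum>j\<in>?I. W s' s i j)"
      by (rule sum.swap)
    ultimately have "(\<Sum>i\<in>?I. \<Sum>j\<in>?I. W s s' i j) - (\<Sum>i\<in>?I. \<Sum>j\<in>?I. W s' s i j) =
        - (\<Sum>i\<in>?I. t (P (br s s') i \<alpha>) (Q (br s s') i X) p)"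
      by (simp add: sum_subtractf)
    then show ?thesis
      by (simp add: twice s)
        (simp add: Econn_comb_args[OF a] anchor_bracket[OF M algebroid s] lie_bracket_apply
          deriv_along_def[of "lie_bracket _ _"] sum_fun_apply)
  qed (simp add: Econn_comb_nonargs)
qed

lemma algebroid_representation_Econn_comb:
  "algebroid_representation M E \<rho> br (tensor_fields M \<kappa>) tensor_scale D"
  unfolding algebroid_representation_def
  using module_connection_Econn_comb Econn_comb_flat by blast

text \<open>Both inductions, over brackets and over partial sums, also carry membership in
  \<open>Sec E\<close>, because flatness and linearity are available only for sections.\<close>

lemma Econn_comb_zero_of_generators:
  assumes t: "t \<in> tensor_fields M \<kappa>" and S: "S \<subseteq> Sec E" "\<And>s. s \<in> S \<Longrightarrow> D s t = 0"
    and gen: "Sec E = Cinf_span M (iterated_brackets br S)" and s: "s \<in> Sec E"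
  shows "D s t = 0"
proof -
  note lin = module_connection_Econn_comb[unfolded module_connection_def]
  \<comment> \<open>The bracket step evaluates the operators at \<open>D b' t\<close> and
    \<open>D b t\<close>, which are the zero tensor.\<close>
  have D0: "D u 0 = 0" if "u \<in> Sec E" for u
  proof (intro ext)
    show "D u 0 \<alpha> X p = 0 \<alpha> X p" for \<alpha> X p
      using vfield_const[OF M anchor_vfield[OF that], of p 0]
      by (cases "tensor_args M \<kappa> \<alpha> X")
        (simp_all add: Econn_comb_args Econn_comb_nonargs deriv_along_def zero_fun_def)
  qed
  have B: "b \<in> Sec E \<and> D b t = 0" if "b \<in> iterated_brackets br S" for b
    using that
  proof induction
    case (generator b)
    then show ?case using S by blast
  next
    case (bracket b b')
    then have b: "b \<in> Sec E" "b' \<in> Sec E" "D b t = 0" "D b' t = 0" by blast+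
    have "D (br b b') t = 0"
      unfolding Econn_comb_flat[OF t b(1,2)] b(3,4) D0[OF b(1)] D0[OF b(2)] by (rule diff_self)
    then show ?case using bracket_Sec b(1,2) by blast
  qed
  obtain k :: nat and f b where fb: "\<forall>j<k. f j \<in> Cinf M \<and> b j \<in> iterated_brackets br S"
    and s_eq: "s = (\<Sum>j<k. fscale (f j) (b j))"
    using s unfolding gen Cinf_span_def by blast
  \<comment> \<open>The bound on \<open>l\<close> is kept because the coefficients and iterated
    brackets are controlled only below \<open>k\<close>.\<close>
  have "(\<Sum>j<l. fscale (f j) (b j)) \<in> Sec E \<and> D (\<Sum>j<l. fscale (f j) (b j)) t = 0" if "l \<le> k" for l
    using that
  proof (induction l)
    case 0
    \<comment> \<open>The zero section is the empty combination; additivity of \<open>D\<close> in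
      the section then forces \<open>D 0 t\<close> to vanish.\<close>
    have z: "0 \<in> Sec E" unfolding gen Cinf_span_def by (auto intro!: exI[of _ 0])
    then have "D (0 + 0) t = D 0 t + D 0 t" using lin t by blast
    then have "D 0 t = 0" by simp
    then show ?case using z by (simp only: lessThan_0 sum.empty simp_thms)
  next
    case (Suc l)
    then have b: "f l \<in> Cinf M" "b l \<in> Sec E" "D (b l) t = 0" using fb B by auto
    have fs: "fscale (f l) (b l) \<in> Sec E" by (rule Sec_fscale[OF M ivector b(2,1)])
    have "D (fscale (f l) (b l)) t = tensor_scale (f l) (D (b l) t)" using lin t b by blast
    then have "D (fscale (f l) (b l)) t = 0" by (simp add: b tensor_scale_def fscale_def fun_eq_iff)
    note fs0 = this
    let ?s = "\<Sum>j<l. fscale (f j) (b j)"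
    have IH: "?s \<in> Sec E" "D ?s t = 0" using Suc.IH Suc_leD[OF Suc.prems] by blast+
    have "D (?s + fscale (f l) (b l)) t = D ?s t + D (fscale (f l) (b l)) t"
      using lin t IH(1) fs by blast
    then have "D (?s + fscale (f l) (b l)) t = 0" unfolding IH(2) fs0 add_0 .
    then show ?case
      unfolding sum.lessThan_Suc using Sec_add[OF M ivector IH(1) fs] by blast
  qed
  then show ?thesis using s_eq by blast
qed

end

text \<open>The embedding intertwines the anchors and, by extension, the connections. The induced
  operators on vector fields and 1-forms therefore coincide, and the operator on tensors is built
  from these alone.\<close>

lemma Econn_comb_extends:
  fixes M :: "'m::{t2_space,second_countable_topology} mfd"
  assumes M: "smooth_manifold M" and E: "anchored_bundle M E \<rho>"
    and nab: "\<And>i. i < length \<kappa> \<Longrightarrow> connection M E (nab i)"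
    and \<iota>: "anchored_morphism E \<rho> F \<sigma> \<iota>"
    and extends: "\<And>i. i < length \<kappa> \<Longrightarrow> extends_connection M E \<iota> (nab i) (nab' i)"
    and s: "s \<in> Sec E"
  shows "Econn_comb M \<sigma> \<kappa> nab' (app \<iota> s) t = Econn_comb M \<rho> \<kappa> nab s t"
proof -
  have iv: "ivector_bundle M E" using E by (simp add: anchored_bundle_def)
  \<comment> \<open>The anchors are compatible only on the fibres of \<open>E\<close>, so the values
    of a section must be known to lie there.\<close>
  have anchor: "app \<sigma> (app \<iota> u) = app \<rho> u" if "u \<in> Sec E" for u
    using \<iota> Sec_in_ifibre[OF M iv that] by (auto simp: anchored_morphism_def app_def fun_eq_iff)
  have TM: "Econn_TM \<sigma> (nab' i) (app \<iota> s) v = Econn_TM \<rho> (nab i) s v"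
    if i: "i < length \<kappa>" and v: "v \<in> vfields M" for i v
  proof -
    have "nab i s v \<in> Sec E" using nab[OF i] s v by (auto simp: connection_def vforms_def)
    then show ?thesis
      using extends[OF i] s v by (simp add: Econn_TM_def anchor extends_connection_def)
  qed
  have T'M: "Econn_T'M M \<sigma> (nab' i) (app \<iota> s) \<omega> = Econn_T'M M \<rho> (nab i) s \<omega>"
    if "i < length \<kappa>" for i \<omega>
    by (simp add: Econn_T'M_def anchor[OF s] TM[OF that] cong: if_cong)
  show ?thesis
  proof (intro ext)
    fix \<alpha> X p
    show "Econn_comb M \<sigma> \<kappa> nab' (app \<iota> s) t \<alpha> X p = Econn_comb M \<rho> \<kappa> nab s t \<alpha> X p"
    proof (cases "tensor_args M \<kappa> \<alpha> X")
      case True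
      have "form_update M \<sigma> \<kappa> nab' (app \<iota> s) i \<alpha> = form_update M \<rho> \<kappa> nab s i \<alpha>"
        "vec_update \<sigma> \<kappa> nab' (app \<iota> s) i X = vec_update \<rho> \<kappa> nab s i X" if "i < length \<kappa>" for i
        using True that TM[OF that] T'M[OF that]
        by (auto simp: form_update_def vec_update_def tensor_args_def split: variance.splits)
      then show ?thesis by (simp add: Econn_comb_args[OF True] anchor[OF s])
    qed (simp add: Econn_comb_nonargs)
  qed
qed

text \<open>Identifies m = r + s with the number of tensor positions, so the connections indexed
  below m are exactly those used by the operator.\<close>

lemma length_eq_count_variance: "length \<kappa> = count_list \<kappa> Contra + count_list \<kappa> Co"
proof (induction \<kappa>)
  case (Cons x \<kappa>)
  then show ?case by (cases x) auto
qed simp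

theorem proposition1:
  fixes M :: "'m::{t2_space,second_countable_topology} mfd"
    and E :: "('m, 'v::real_vector) ivbundle" and \<rho> :: "'m \<Rightarrow> 'v \<Rightarrow> 'm tvec"
    and nab :: "nat \<Rightarrow> ('m, 'v) conn"
    and m r s :: nat and \<kappa> :: "variance list" and t :: "'m tensor"
    and F :: "('m, 'w::real_vector) ivbundle" and \<sigma> :: "'m \<Rightarrow> 'w \<Rightarrow> 'm tvec"
    and br :: "('m \<Rightarrow> 'w) \<Rightarrow> ('m \<Rightarrow> 'w) \<Rightarrow> 'm \<Rightarrow> 'w" and \<iota> :: "'m \<Rightarrow> 'v \<Rightarrow> 'w"
    and nab' :: "nat \<Rightarrow> ('m, 'w) conn"
  assumes "smooth_manifold M"
    and "anchored_bundle M E \<rho>"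
    and "\<And>i. i < m \<Longrightarrow> connection M E (nab i)"
    and "count_list \<kappa> Contra = r" and "count_list \<kappa> Co = s" and "r + s = m"
    and "t \<in> tensor_fields M \<kappa>"
    and "compatible M E \<rho> nab \<kappa> t"
    and "free_lie_algebroid TYPE('c::real_vector) M E \<rho> F \<sigma> br \<iota>"
    and "\<And>i. i < m \<Longrightarrow> cartan_connection M F \<sigma> br (nab' i)"
    and "\<And>i. i < m \<Longrightarrow> extends_connection M E \<iota> (nab i) (nab' i)"
  shows "compatible M F \<sigma> nab' \<kappa> t \<and>
         algebroid_representation M F \<sigma> br (tensor_fields M \<kappa>) tensor_scale
           (Econn_comb M \<sigma> \<kappa> nab') \<and>
         invariant F (Econn_comb M \<sigma> \<kappa> nab') t"
proof -
  have len: "length \<kappa> = m" using assms(4-6) length_eq_count_variance[of \<kappa>] by simp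
  note free = assms(9)[unfolded free_lie_algebroid_def]
  have F: "lie_algebroid M F \<sigma> br" and \<iota>: "anchored_morphism E \<rho> F \<sigma> \<iota>"
    and gen: "Sec F = Cinf_span M (iterated_brackets br (app \<iota> ` Sec E))"
    using free by blast+
  have "anchored_bundle M F \<sigma>" using F unfolding lie_algebroid_def by blast
  then interpret cartan_connections M F \<sigma> \<kappa> nab' br
    using assms(1,10) F len by unfold_locales (auto simp: cartan_connection_def)
  have "app \<iota> ` Sec E \<subseteq> Sec F"
    using \<iota> bundle_map_Sec[OF assms(1)] by (auto simp: anchored_morphism_def)
  moreover have "D u t = 0" if "u \<in> app \<iota> ` Sec E" for u
    using that assms(3,8,11) Econn_comb_extends[OF assms(1,2) _ \<iota>, of \<kappa> nab nab'] len
    by (auto simp: compatible_def)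
  ultimately have "D u t = 0" if "u \<in> Sec F" for u
    using Econn_comb_zero_of_generators[OF assms(7) _ _ gen that] by blast
  \<comment> \<open>Compatibility and invariance unfold to the same vanishing statement.\<close>
  then show ?thesis
    using algebroid_representation_Econn_comb by (simp add: compatible_def invariant_def)
qed

end
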